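(* Let $(\mathrm{CoFib},\mathrm{Fib},\mathrm{Weq})$ be a model structure on an exact category $\mathcal{A}$. Let $\mathcal{C}$ be the class of cofibrant objects and $\mathrm{T}\mathcal{F}$ the class of trivially fibrant objects. Then the following are equivalent. (1) Cofibrations are exactly the inflations with cofibrant cokernel, and any trivial fibration is a deflation. (2) $\operatorname{Ext}^1_{\mathcal{A}}(\mathcal{C},\mathrm{T}\mathcal{F})=0$, any cofibration is an inflation, and any trivial fibration is a deflation. (3) Trivial fibrations are exactly the deflations with trivially fibrant kernel, and any cofibration is an inflation. (4) Cofibrations are exactly the inflations with cofibrant cokernel, and trivial fibrations are exactly the deflations with trivially fibrant kernel. Moreover, if in addition $\mathcal{A}$ is weakly idempotent complete, then all the conditions above are equivalent to (5) $(\mathcal{C},\mathrm{T}\mathcal{F})$ is a complete cotorsion pair.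
   Context: Exact categories are in the sense of Quillen, with conflations $X\xrightarrow{i}Y\xrightarrow{d}Z$, inflations $i$, deflations $d$; $0\to X\to Y\to Z\to 0$ is then called an admissible exact sequence. An exact category is weakly idempotent complete if every splitting epimorphism is a deflation. $\operatorname{Ext}^1_{\mathcal{A}}$ is the Yoneda Ext of the exact structure; $\operatorname{Ext}^1_{\mathcal{A}}(\mathcal{C},\mathcal{D})=0$ means $\operatorname{Ext}^1_{\mathcal{A}}(C,D)=0$ for all $C\in\mathcal{C}$, $D\in\mathcal{D}$. A model structure on a category is a triple $(\mathrm{CoFib},\mathrm{Fib},\mathrm{Weq})$ of classes of morphisms (cofibrations, fibrations, weak equivalences) satisfying: (two out of three) if two of $f,g,gf$ are in $\mathrm{Weq}$ so is the third; (retract) each of the three classes is closed under retracts; (lifting) cofibrations have the left lifting property with respect to $\mathrm{Fib}\cap\mathrm{Weq}$, and fibrations have the right lifting property with respect to $\mathrm{CoFib}\cap\mathrm{Weq}$; (factorization) every morphism $f$ factors as $f=pi$ with $i\in\mathrm{CoFib}\cap\mathrm{Weq}$, $p\in\mathrm{Fib}$, and as $f=qj$ with $j\in\mathrm{CoFib}$, $q\in\mathrm{Fib}\cap\mathrm{Weq}$. No limits or colimits are required. Trivial fibrations are the morphisms in $\mathrm{Fib}\cap\mathrm{Weq}$. An object $X$ is cofibrant if $0\to X$ is a cofibration, fibrant if $X\to0$ is a fibration, trivial if $0\to X$ (equivalently $X\to 0$) is a weak equivalence, and trivially fibrant if it is both trivial and fibrant. A cotorsion pair is a pair $(\mathcal{C},\mathcal{F})$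 of classes of objects with $\mathcal{C}=\{X\mid\operatorname{Ext}^1_{\mathcal{A}}(X,F)=0\ \forall F\in\mathcal{F}\}$ and $\mathcal{F}=\{Y\mid\operatorname{Ext}^1_{\mathcal{A}}(C,Y)=0\ \forall C\in\mathcal{C}\}$. It is complete if for every object $X$ there are admissible exact sequences $0\to F\to C\to X\to 0$ and $0\to X\to F'\to C'\to 0$ with $C,C'\in\mathcal{C}$, $F,F'\in\mathcal{F}$. *)

theory Defs
  imports "HOL-Algebra.Group"
begin

section \<open>Categories\<close>

text \<open>
  A category is given by its set of objects and its set of morphisms inside two ambient types.
  The value of the operations outside these sets is irrelevant. \<open>Comp A g f\<close> is
  "first \<open>f\<close>, then \<open>g\<close>".
\<close>

record ('o, 'm) category =
  Obj :: "'o set"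
  Mor :: "'m set"
  Dom :: "'m \<Rightarrow> 'o"
  Cod :: "'m \<Rightarrow> 'o"
  Id :: "'o \<Rightarrow> 'm"
  Comp :: "'m \<Rightarrow> 'm \<Rightarrow> 'm" (infixr "\<cdot>\<index>" 75)

definition homset :: "('o, 'm, 'z) category_scheme \<Rightarrow> 'o \<Rightarrow> 'o \<Rightarrow> 'm set" where
  "homset A X Y = {f \<in> Mor A. Dom A f = X \<and> Cod A f = Y}"

locale category =
  fixes A :: "('o, 'm, 'z) category_scheme" (structure)
  assumes Dom_Obj: "f \<in> Mor A \<Longrightarrow> Dom A f \<in> Obj A"
    and Cod_Obj: "f \<in> Mor A \<Longrightarrow> Cod A f \<in> Obj A"
    and Id_hom: "X \<in> Obj A \<Longrightarrow> Id A X \<in> homset A X X"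
    and Comp_hom: "\<lbrakk>f \<in> homset A X Y; g \<in> homset A Y Z\<rbrakk> \<Longrightarrow> g \<cdot> f \<in> homset A X Z"
    and Comp_Id: "f \<in> homset A X Y \<Longrightarrow> f \<cdot> Id A X = f"
    and Id_Comp: "f \<in> homset A X Y \<Longrightarrow> Id A Y \<cdot> f = f"
    and Comp_assoc: "\<lbrakk>f \<in> homset A W X; g \<in> homset A X Y; h \<in> homset A Y Z\<rbrakk>
      \<Longrightarrow> (h \<cdot> g) \<cdot> f = h \<cdot> (g \<cdot> f)"

definition is_iso :: "('o, 'm, 'z) category_scheme \<Rightarrow> 'm \<Rightarrow> bool" where
  "is_iso A f \<longleftrightarrow> f \<in> Mor A \<and>
     (\<exists>g \<in> homset A (Cod A f) (Dom A f).
        Comp A g f = Id A (Dom A f) \<and> Comp A f g = Id A (Cod A f))"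

definition split_epi :: "('o, 'm, 'z) category_scheme \<Rightarrow> 'm \<Rightarrow> bool" where
  "split_epi A f \<longleftrightarrow> f \<in> Mor A \<and>
     (\<exists>s \<in> homset A (Cod A f) (Dom A f). Comp A f s = Id A (Cod A f))"

definition zero_object :: "('o, 'm, 'z) category_scheme \<Rightarrow> 'o \<Rightarrow> bool" where
  "zero_object A Z \<longleftrightarrow> Z \<in> Obj A \<and>
     (\<forall>X \<in> Obj A. (\<exists>!f. f \<in> homset A Z X) \<and> (\<exists>!f. f \<in> homset A X Z))"

text \<open>
  \<open>is_pullback A f g p q\<close>: the commutative square \<open>f \<cdot> p = g \<cdot> q\<close> is cartesian.
  \<open>is_pushout A f g p q\<close>: the commutative square \<open>p \<cdot> f = q \<cdot> g\<close> is cocartesian.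
  In both cases \<open>q\<close> is opposite to \<open>f\<close> and \<open>p\<close> is opposite to \<open>g\<close>.
\<close>

definition is_pullback :: "('o, 'm, 'z) category_scheme \<Rightarrow> 'm \<Rightarrow> 'm \<Rightarrow> 'm \<Rightarrow> 'm \<Rightarrow> bool" where
  "is_pullback A f g p q \<longleftrightarrow>
     f \<in> Mor A \<and> g \<in> Mor A \<and> Cod A f = Cod A g \<and>
     p \<in> Mor A \<and> q \<in> Mor A \<and> Dom A p = Dom A q \<and>
     Cod A p = Dom A f \<and> Cod A q = Dom A g \<and> Comp A f p = Comp A g q \<and>
     (\<forall>T \<in> Obj A. \<forall>u \<in> homset A T (Dom A f). \<forall>v \<in> homset A T (Dom A g).
        Comp A f u = Comp A g v \<longrightarrow>
        (\<exists>!w. w \<in> homset A T (Dom A p) \<and> Comp A p w = u \<and> Comp A q w = v))"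

definition is_pushout :: "('o, 'm, 'z) category_scheme \<Rightarrow> 'm \<Rightarrow> 'm \<Rightarrow> 'm \<Rightarrow> 'm \<Rightarrow> bool" where
  "is_pushout A f g p q \<longleftrightarrow>
     f \<in> Mor A \<and> g \<in> Mor A \<and> Dom A f = Dom A g \<and>
     p \<in> Mor A \<and> q \<in> Mor A \<and> Cod A p = Cod A q \<and>
     Dom A p = Cod A f \<and> Dom A q = Cod A g \<and> Comp A p f = Comp A q g \<and>
     (\<forall>T \<in> Obj A. \<forall>u \<in> homset A (Cod A f) T. \<forall>v \<in> homset A (Cod A g) T.
        Comp A u f = Comp A v g \<longrightarrow>
        (\<exists>!w. w \<in> homset A (Cod A p) T \<and> Comp A w p = u \<and> Comp A w q = v))"


section \<open>Additive categories\<close>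

record ('o, 'm) additive_category = "('o, 'm) category" +
  Add :: "'m \<Rightarrow> 'm \<Rightarrow> 'm" (infixl "\<boxplus>\<index>" 65)
  Zero :: "'o \<Rightarrow> 'o \<Rightarrow> 'm"

definition hom_group ::
  "('o, 'm, 'z) additive_category_scheme \<Rightarrow> 'o \<Rightarrow> 'o \<Rightarrow> 'm monoid" where
  "hom_group A X Y = \<lparr>carrier = homset A X Y, monoid.mult = Add A, one = Zero A X Y\<rparr>"

definition is_biproduct ::
  "('o, 'm, 'z) additive_category_scheme \<Rightarrow> 'o \<Rightarrow> 'o \<Rightarrow> 'o \<Rightarrow> 'm \<Rightarrow> 'm \<Rightarrow> 'm \<Rightarrow> 'm \<Rightarrow> bool" where
  "is_biproduct A X Y B i1 i2 p1 p2 \<longleftrightarrow>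
     X \<in> Obj A \<and> Y \<in> Obj A \<and> B \<in> Obj A \<and>
     i1 \<in> homset A X B \<and> i2 \<in> homset A Y B \<and> p1 \<in> homset A B X \<and> p2 \<in> homset A B Y \<and>
     Comp A p1 i1 = Id A X \<and> Comp A p2 i2 = Id A Y \<and>
     Comp A p2 i1 = Zero A X Y \<and> Comp A p1 i2 = Zero A Y X \<and>
     Add A (Comp A i1 p1) (Comp A i2 p2) = Id A B"

locale additive_category = category A
  for A :: "('o, 'm, 'z) additive_category_scheme" (structure) +
  assumes hom_comm_group: "\<lbrakk>X \<in> Obj A; Y \<in> Obj A\<rbrakk> \<Longrightarrow> comm_group (hom_group A X Y)"
    and Comp_Add_right: "\<lbrakk>f \<in> homset A X Y; g \<in> homset A X Y; h \<in> homset A Y Z\<rbrakk>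
      \<Longrightarrow> h \<cdot> (f \<boxplus> g) = (h \<cdot> f) \<boxplus> (h \<cdot> g)"
    and Comp_Add_left: "\<lbrakk>f \<in> homset A X Y; g \<in> homset A Y Z; h \<in> homset A Y Z\<rbrakk>
      \<Longrightarrow> (g \<boxplus> h) \<cdot> f = (g \<cdot> f) \<boxplus> (h \<cdot> f)"
    and ex_zero_object: "\<exists>Z. zero_object A Z"
    and ex_biproduct: "\<lbrakk>X \<in> Obj A; Y \<in> Obj A\<rbrakk> \<Longrightarrow> \<exists>B i1 i2 p1 p2. is_biproduct A X Y B i1 i2 p1 p2"

definition is_kernel :: "('o, 'm, 'z) additive_category_scheme \<Rightarrow> 'm \<Rightarrow> 'm \<Rightarrow> bool" where
  "is_kernel A f k \<longleftrightarrow>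
     f \<in> Mor A \<and> k \<in> Mor A \<and> Cod A k = Dom A f \<and>
     Comp A f k = Zero A (Dom A k) (Cod A f) \<and>
     (\<forall>T \<in> Obj A. \<forall>u \<in> homset A T (Dom A f). Comp A f u = Zero A T (Cod A f) \<longrightarrow>
        (\<exists>!w. w \<in> homset A T (Dom A k) \<and> Comp A k w = u))"

definition is_cokernel :: "('o, 'm, 'z) additive_category_scheme \<Rightarrow> 'm \<Rightarrow> 'm \<Rightarrow> bool" where
  "is_cokernel A f c \<longleftrightarrow>
     f \<in> Mor A \<and> c \<in> Mor A \<and> Dom A c = Cod A f \<and>
     Comp A c f = Zero A (Dom A f) (Cod A c) \<and>
     (\<forall>T \<in> Obj A. \<forall>u \<in> homset A (Cod A f) T. Comp A u f = Zero A (Dom A f) T \<longrightarrow>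
        (\<exists>!w. w \<in> homset A (Cod A c) T \<and> Comp A w c = u))"


section \<open>Exact categories\<close>

record ('o, 'm) exact_category = "('o, 'm) additive_category" +
  Conf :: "('m \<times> 'm) set"

definition inflations :: "('o, 'm, 'z) exact_category_scheme \<Rightarrow> 'm set" where
  "inflations A = {i. \<exists>d. (i, d) \<in> Conf A}"

definition deflations :: "('o, 'm, 'z) exact_category_scheme \<Rightarrow> 'm set" where
  "deflations A = {d. \<exists>i. (i, d) \<in> Conf A}"

text \<open>
  Quillen's axioms in the self-dual form of T. Buehler, \<^emph>\<open>Exact categories\<close>, Definition 2.1.
\<close>

locale exact_category = additive_category A
  for A :: "('o, 'm, 'z) exact_category_scheme" (structure) +
  assumes Conf_kernel: "(i, d) \<in> Conf A \<Longrightarrow> is_kernel A d i"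
    and Conf_cokernel: "(i, d) \<in> Conf A \<Longrightarrow> is_cokernel A i d"
    and Conf_iso: "\<lbrakk>(i, d) \<in> Conf A; is_iso A a; is_iso A b; is_iso A c;
        Dom A a = Dom A i; Dom A b = Cod A i; Dom A c = Cod A d;
        i' \<in> homset A (Cod A a) (Cod A b); d' \<in> homset A (Cod A b) (Cod A c);
        b \<cdot> i = i' \<cdot> a; c \<cdot> d = d' \<cdot> b\<rbrakk> \<Longrightarrow> (i', d') \<in> Conf A"
    and Id_inflation: "X \<in> Obj A \<Longrightarrow> Id A X \<in> inflations A"
    and Id_deflation: "X \<in> Obj A \<Longrightarrow> Id A X \<in> deflations A"
    and inflation_Comp: "\<lbrakk>i \<in> inflations A; j \<in> inflations A; Dom A j = Cod A i\<rbrakk>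
      \<Longrightarrow> j \<cdot> i \<in> inflations A"
    and deflation_Comp: "\<lbrakk>d \<in> deflations A; e \<in> deflations A; Dom A e = Cod A d\<rbrakk>
      \<Longrightarrow> e \<cdot> d \<in> deflations A"
    and inflation_pushout: "\<lbrakk>i \<in> inflations A; f \<in> Mor A; Dom A f = Dom A i\<rbrakk>
      \<Longrightarrow> \<exists>f' i'. is_pushout A i f f' i' \<and> i' \<in> inflations A"
    and deflation_pullback: "\<lbrakk>d \<in> deflations A; f \<in> Mor A; Cod A f = Cod A d\<rbrakk>
      \<Longrightarrow> \<exists>f' d'. is_pullback A d f f' d' \<and> d' \<in> deflations A"

definition weakly_idempotent_complete :: "('o, 'm, 'z) exact_category_scheme \<Rightarrow> bool" where
  "weakly_idempotent_complete A \<longleftrightarrow> (\<forall>f. split_epi A f \<longrightarrow> f \<in> deflations A)"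


section \<open>Yoneda Ext and cotorsion pairs\<close>

definition extensions ::
  "('o, 'm, 'z) exact_category_scheme \<Rightarrow> 'o \<Rightarrow> 'o \<Rightarrow> ('m \<times> 'm) set" where
  "extensions A X Y = {(i, d) \<in> Conf A. Dom A i = Y \<and> Cod A d = X}"

definition extension_equiv ::
  "('o, 'm, 'z) exact_category_scheme \<Rightarrow> 'o \<Rightarrow> 'o \<Rightarrow> (('m \<times> 'm) \<times> ('m \<times> 'm)) set" where
  "extension_equiv A X Y = {((i, d), (i', d')).
     (i, d) \<in> extensions A X Y \<and> (i', d') \<in> extensions A X Y \<and>
     (\<exists>b \<in> homset A (Cod A i) (Cod A i'). is_iso A b \<and> Comp A b i = i' \<and> Comp A d' b = d)}"

definition Ext1 :: "('o, 'm, 'z) exact_category_scheme \<Rightarrow> 'o \<Rightarrow> 'o \<Rightarrow> ('m \<times> 'm) set set" where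
  "Ext1 A X Y = extensions A X Y // extension_equiv A X Y"

text \<open>
  The neutral element of the Baer sum on \<open>Ext1 A X Y\<close>: the class of
  \<open>0 \<rightarrow> Y \<rightarrow> Y \<oplus> X \<rightarrow> X \<rightarrow> 0\<close>, which does not depend on the choice of the direct sum.
\<close>

definition Ext1_zero :: "('o, 'm, 'z) exact_category_scheme \<Rightarrow> 'o \<Rightarrow> 'o \<Rightarrow> ('m \<times> 'm) set" where
  "Ext1_zero A X Y =
     {e. \<exists>B i1 i2 p1 p2. is_biproduct A Y X B i1 i2 p1 p2 \<and> ((i1, p2), e) \<in> extension_equiv A X Y}"

definition Ext1_vanishes :: "('o, 'm, 'z) exact_category_scheme \<Rightarrow> 'o set \<Rightarrow> 'o set \<Rightarrow> bool" where
  "Ext1_vanishes A \<C> \<D> \<longleftrightarrow> (\<forall>X \<in> \<C>. \<forall>Y \<in> \<D>. Ext1 A X Y = {Ext1_zero A X Y})"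

definition cotorsion_pair :: "('o, 'm, 'z) exact_category_scheme \<Rightarrow> 'o set \<Rightarrow> 'o set \<Rightarrow> bool" where
  "cotorsion_pair A \<C> \<F> \<longleftrightarrow>
     \<C> = {X \<in> Obj A. \<forall>Y \<in> \<F>. Ext1 A X Y = {Ext1_zero A X Y}} \<and>
     \<F> = {Y \<in> Obj A. \<forall>X \<in> \<C>. Ext1 A X Y = {Ext1_zero A X Y}}"

definition complete_cotorsion_pair ::
  "('o, 'm, 'z) exact_category_scheme \<Rightarrow> 'o set \<Rightarrow> 'o set \<Rightarrow> bool" where
  "complete_cotorsion_pair A \<C> \<F> \<longleftrightarrow> cotorsion_pair A \<C> \<F> \<and>
     (\<forall>X \<in> Obj A.
        (\<exists>(i, d) \<in> Conf A. Dom A i \<in> \<F> \<and> Cod A i \<in> \<C> \<and> Cod A d = X) \<and>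
        (\<exists>(i, d) \<in> Conf A. Dom A i = X \<and> Cod A i \<in> \<F> \<and> Cod A d \<in> \<C>))"


section \<open>Model structures\<close>

definition retract_of :: "('o, 'm, 'z) category_scheme \<Rightarrow> 'm \<Rightarrow> 'm \<Rightarrow> bool" where
  "retract_of A f g \<longleftrightarrow> f \<in> Mor A \<and> g \<in> Mor A \<and>
     (\<exists>s \<in> homset A (Dom A f) (Dom A g). \<exists>r \<in> homset A (Dom A g) (Dom A f).
      \<exists>s' \<in> homset A (Cod A f) (Cod A g). \<exists>r' \<in> homset A (Cod A g) (Cod A f).
        Comp A r s = Id A (Dom A f) \<and> Comp A r' s' = Id A (Cod A f) \<and>
        Comp A g s = Comp A s' f \<and> Comp A f r = Comp A r' g)"

definition has_lifting :: "('o, 'm, 'z) category_scheme \<Rightarrow> 'm \<Rightarrow> 'm \<Rightarrow> bool" where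
  "has_lifting A i p \<longleftrightarrow>
     (\<forall>u \<in> homset A (Dom A i) (Dom A p). \<forall>v \<in> homset A (Cod A i) (Cod A p).
        Comp A p u = Comp A v i \<longrightarrow>
        (\<exists>h \<in> homset A (Cod A i) (Dom A p). Comp A h i = u \<and> Comp A p h = v))"

locale model_structure = category A
  for A :: "('o, 'm, 'z) category_scheme" (structure) +
  fixes CoFib Fib Weq :: "'m set"
  assumes CoFib_Mor: "CoFib \<subseteq> Mor A" and Fib_Mor: "Fib \<subseteq> Mor A" and Weq_Mor: "Weq \<subseteq> Mor A"
    and two_of_three:
      "\<lbrakk>f \<in> homset A X Y; g \<in> homset A Y Z; f \<in> Weq; g \<in> Weq\<rbrakk> \<Longrightarrow> g \<cdot> f \<in> Weq"
      "\<lbrakk>f \<in> homset A X Y; g \<in> homset A Y Z; f \<in> Weq; g \<cdot> f \<in> Weq\<rbrakk> \<Longrightarrow> g \<in> Weq"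
      "\<lbrakk>f \<in> homset A X Y; g \<in> homset A Y Z; g \<in> Weq; g \<cdot> f \<in> Weq\<rbrakk> \<Longrightarrow> f \<in> Weq"
    and retract_CoFib: "\<lbrakk>retract_of A f g; g \<in> CoFib\<rbrakk> \<Longrightarrow> f \<in> CoFib"
    and retract_Fib: "\<lbrakk>retract_of A f g; g \<in> Fib\<rbrakk> \<Longrightarrow> f \<in> Fib"
    and retract_Weq: "\<lbrakk>retract_of A f g; g \<in> Weq\<rbrakk> \<Longrightarrow> f \<in> Weq"
    and lifting_CoFib: "\<lbrakk>i \<in> CoFib; p \<in> Fib \<inter> Weq\<rbrakk> \<Longrightarrow> has_lifting A i p"
    and lifting_Fib: "\<lbrakk>i \<in> CoFib \<inter> Weq; p \<in> Fib\<rbrakk> \<Longrightarrow> has_lifting A i p"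
    and factor_trivial_CoFib_Fib: "f \<in> Mor A \<Longrightarrow>
      \<exists>i p. i \<in> CoFib \<inter> Weq \<and> p \<in> Fib \<and> Dom A p = Cod A i \<and> f = p \<cdot> i"
    and factor_CoFib_trivial_Fib: "f \<in> Mor A \<Longrightarrow>
      \<exists>j q. j \<in> CoFib \<and> q \<in> Fib \<inter> Weq \<and> Dom A q = Cod A j \<and> f = q \<cdot> j"

text \<open>
  For a zero object \<open>Z\<close>, \<open>Zero A Z X\<close> and \<open>Zero A X Z\<close> are the unique morphisms \<open>Z \<rightarrow> X\<close> and
  \<open>X \<rightarrow> Z\<close>. As the three classes of a model structure are closed under retracts, hence under
  isomorphisms of morphisms, the choice of the zero object does not matter below.
\<close>

definition cofibrant_objects ::
  "('o, 'm, 'z) additive_category_scheme \<Rightarrow> 'm set \<Rightarrow> 'o set" where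
  "cofibrant_objects A CoFib = {X \<in> Obj A. \<exists>Z. zero_object A Z \<and> Zero A Z X \<in> CoFib}"

definition fibrant_objects ::
  "('o, 'm, 'z) additive_category_scheme \<Rightarrow> 'm set \<Rightarrow> 'o set" where
  "fibrant_objects A Fib = {X \<in> Obj A. \<exists>Z. zero_object A Z \<and> Zero A X Z \<in> Fib}"

definition trivial_objects ::
  "('o, 'm, 'z) additive_category_scheme \<Rightarrow> 'm set \<Rightarrow> 'o set" where
  "trivial_objects A Weq = {X \<in> Obj A. \<exists>Z. zero_object A Z \<and> Zero A Z X \<in> Weq}"

definition trivially_fibrant_objects ::
  "('o, 'm, 'z) additive_category_scheme \<Rightarrow> 'm set \<Rightarrow> 'm set \<Rightarrow> 'o set" where
  "trivially_fibrant_objects A Fib Weq = trivial_objects A Weq \<inter> fibrant_objects A Fib"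


section \<open>Inflations with prescribed cokernel, deflations with prescribed kernel\<close>

definition inflations_with_cokernel_in ::
  "('o, 'm, 'z) exact_category_scheme \<Rightarrow> 'o set \<Rightarrow> 'm set" where
  "inflations_with_cokernel_in A \<C> =
     {i \<in> inflations A. \<exists>c. is_cokernel A i c \<and> Cod A c \<in> \<C>}"

definition deflations_with_kernel_in ::
  "('o, 'm, 'z) exact_category_scheme \<Rightarrow> 'o set \<Rightarrow> 'm set" where
  "deflations_with_kernel_in A \<F> =
     {d \<in> deflations A. \<exists>k. is_kernel A d k \<and> Dom A k \<in> \<F>}"

end

theory Submission
  imports Defs
begin

text \<open>
  Cofibrations and trivial fibrations form a weak factorization system \<open>(L, R)\<close>, and only this is
  used. Condition (2) is self-dual and (3) is the dual of (1), so it suffices to compare (1) with (2).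
  An object is cofibrant iff it is projective with respect to \<open>R\<close>, hence cokernels of cofibrations
  are cofibrant; conversely, vanishing of \<open>Ext\<^sup>1\<close> lets one lift inflations with cofibrant cokernel
  against deflations with trivially fibrant kernel. Factoring \<open>0 \<rightarrow> X\<close> and \<open>X \<rightarrow> 0\<close> gives
  completeness of the cotorsion pair. If conversely every object \<open>Y\<close> has a deflation \<open>C \<rightarrow> Y\<close> with
  \<open>C\<close> cofibrant, it lifts along any trivial fibration \<open>p\<close> to \<open>Y\<close>, and weak idempotent
  completeness makes \<open>p\<close> a deflation.
\<close>

section \<open>Categories and their opposites\<close>

text \<open>No limits are postulated: only inflations can be pushed out and only deflations pulled
  back. Knowing that \<open>R\<close> consists of deflations therefore lets a lifting problem for an
  inflation with codomain Y be pulled back to a deflation P to Y, where a lift becomes a section.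
  The obstacle is that Y is not cofibrant, so this deflation need not split. The section is already
  prescribed on the domain of the inflation; dividing that part out leaves an extension of the
  cofibrant cokernel by a fibrant kernel, which does split. One explicit pushout thus does the work
  of a long exact sequence. \<open>Ext1\<close> is accordingly reduced to the existence of
  retractions, a form that survives reversal of arrows. Duality is formal: \<open>opposite A\<close>
  is again an exact category, in which \<open>L\<close> and \<open>R\<close> trade places, and dual
  statements come from interpreting the locales there. In the last equivalence the difficulty is
  that a trivial fibration not yet known to be a deflation has no kernel to work with. Weak
  idempotent completeness supplies one through a split epimorphism.\<close>

lemma homset_iff: "f \<in> homset A X Y \<longleftrightarrow> f \<in> Mor A \<and> Dom A f = X \<and> Cod A f = Y"
  by (simp add: homset_def)

section \<open>Composition, lifting, isomorphisms and pushouts\<close>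

context category
begin

lemma Comp_simps [simp]:
  assumes "f \<in> Mor A" "g \<in> Mor A" "Dom A g = Cod A f"
  shows "g \<cdot> f \<in> Mor A" "Dom A (g \<cdot> f) = Dom A f" "Cod A (g \<cdot> f) = Cod A g"
  using Comp_hom[of f "Dom A f" "Cod A f" g "Cod A g"] assms by (simp_all add: homset_iff)

lemma Comp_assoc_Mor [simp]:
  assumes "f \<in> Mor A" "g \<in> Mor A" "h \<in> Mor A" "Dom A g = Cod A f" "Dom A h = Cod A g"
  shows "(h \<cdot> g) \<cdot> f = h \<cdot> (g \<cdot> f)"
  using Comp_assoc[of f "Dom A f" "Cod A f" g "Cod A g" h "Cod A h"] assms
  by (simp add: homset_iff)

lemma Id_simps [simp]:
  assumes "X \<in> Obj A"
  shows "Id A X \<in> Mor A" "Dom A (Id A X) = X" "Cod A (Id A X) = X"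
  using Id_hom[OF assms] by (simp_all add: homset_iff)

lemma Comp_Id_Mor [simp]: "\<lbrakk>f \<in> Mor A; Dom A f = X\<rbrakk> \<Longrightarrow> f \<cdot> Id A X = f"
  using Comp_Id[of f X "Cod A f"] by (simp add: homset_iff)

lemma Id_Comp_Mor [simp]: "\<lbrakk>f \<in> Mor A; Cod A f = Y\<rbrakk> \<Longrightarrow> Id A Y \<cdot> f = f"
  using Id_Comp[of f "Dom A f" Y] by (simp add: homset_iff)

declare Dom_Obj [simp] Cod_Obj [simp]

text \<open>Composites are normalised to the right by \<open>Comp_assoc_Mor\<close>, which hides the
  left side of \<open>g \<cdot> f = k \<cdot> h\<close> inside
  \<open>g \<cdot> (f \<cdot> x)\<close>. This lemma and the next restate such equations in normal
  form, so that commutative squares can serve as rewrite rules.\<close>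

lemma Comp_eq_extend:
  assumes "g \<cdot> f = k \<cdot> h" and "f \<in> Mor A" "g \<in> Mor A" "h \<in> Mor A" "k \<in> Mor A"
    "Dom A g = Cod A f" "Dom A k = Cod A h" "x \<in> Mor A" "Cod A x = Dom A f" "Cod A x = Dom A h"
  shows "g \<cdot> (f \<cdot> x) = k \<cdot> (h \<cdot> x)"
  using assms by (metis Comp_assoc_Mor)

lemma Comp_eq_extend1:
  assumes "g \<cdot> f = k" and "f \<in> Mor A" "g \<in> Mor A"
    "Dom A g = Cod A f" "x \<in> Mor A" "Cod A x = Dom A f"
  shows "g \<cdot> (f \<cdot> x) = k \<cdot> x"
  using assms by (metis Comp_assoc_Mor)

lemma has_liftingE:
  assumes "has_lifting A i p" "u \<in> Mor A" "v \<in> Mor A" "Dom A u = Dom A i" "Cod A u = Dom A p"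
    "Dom A v = Cod A i" "Cod A v = Cod A p" "p \<cdot> u = v \<cdot> i"
  obtains h where "h \<in> Mor A" "Dom A h = Cod A i" "Cod A h = Dom A p" "h \<cdot> i = u" "p \<cdot> h = v"
proof -
  have "u \<in> homset A (Dom A i) (Dom A p)" "v \<in> homset A (Cod A i) (Cod A p)"
    using assms by (simp_all add: homset_iff)
  then obtain h where "h \<in> homset A (Cod A i) (Dom A p)" "h \<cdot> i = u" "p \<cdot> h = v"
    using assms(1,8) unfolding has_lifting_def by blast
  then show ?thesis using that by (auto simp: homset_iff)
qed

lemma retract_ofI:
  assumes "f \<in> Mor A" "g \<in> Mor A" "s \<in> homset A (Dom A f) (Dom A g)"
    "r \<in> homset A (Dom A g) (Dom A f)" "s' \<in> homset A (Cod A f) (Cod A g)"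
    "r' \<in> homset A (Cod A g) (Cod A f)" "r \<cdot> s = Id A (Dom A f)" "r' \<cdot> s' = Id A (Cod A f)"
    "g \<cdot> s = s' \<cdot> f" "f \<cdot> r = r' \<cdot> g"
  shows "retract_of A f g"
  using assms unfolding retract_of_def by blast

lemma is_iso_Id: "X \<in> Obj A \<Longrightarrow> is_iso A (Id A X)"
  unfolding is_iso_def by (auto simp: homset_iff intro!: bexI[of _ "Id A X"])

lemma is_isoI:
  assumes "f \<in> homset A X Y" "g \<in> homset A Y X" "g \<cdot> f = Id A X" "f \<cdot> g = Id A Y"
  shows "is_iso A f"
  using assms unfolding is_iso_def by (auto simp: homset_iff intro!: bexI[of _ g])

lemma is_isoE:
  assumes "is_iso A f"
  obtains g where "g \<in> homset A (Cod A f) (Dom A f)"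
    "g \<cdot> f = Id A (Dom A f)" "f \<cdot> g = Id A (Cod A f)" "is_iso A g"
proof -
  from assms obtain g where g: "f \<in> Mor A" "g \<in> homset A (Cod A f) (Dom A f)"
    "g \<cdot> f = Id A (Dom A f)" "f \<cdot> g = Id A (Cod A f)"
    unfolding is_iso_def by blast
  then have "is_iso A g" by (intro is_isoI[of g "Cod A f" "Dom A f" f]) (auto simp: homset_iff)
  with g that show ?thesis by blast
qed

lemma is_pushoutD:
  assumes "is_pushout A f g p q"
  shows "f \<in> Mor A" "g \<in> Mor A" "Dom A f = Dom A g" "p \<in> Mor A" "q \<in> Mor A"
    "Cod A p = Cod A q" "Dom A p = Cod A f" "Dom A q = Cod A g" "p \<cdot> f = q \<cdot> g"
  using assms unfolding is_pushout_def by auto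

lemma pushout_ex1:
  assumes "is_pushout A f g p q" "u \<in> Mor A" "v \<in> Mor A" "Cod A u = Cod A v"
    "Dom A u = Cod A f" "Dom A v = Cod A g" "u \<cdot> f = v \<cdot> g"
  shows "\<exists>!w. w \<in> homset A (Cod A q) (Cod A v) \<and> w \<cdot> p = u \<and> w \<cdot> q = v"
proof -
  have "u \<in> homset A (Cod A f) (Cod A v)" "v \<in> homset A (Cod A g) (Cod A v)"
    "Cod A v \<in> Obj A"
    using assms by (auto simp: homset_iff)
  then have "\<exists>!w. w \<in> homset A (Cod A p) (Cod A v) \<and> w \<cdot> p = u \<and> w \<cdot> q = v"
    using assms(1,7) unfolding is_pushout_def by blast
  then show ?thesis by (simp only: is_pushoutD(6)[OF assms(1)])
qed

lemma pushout_factor: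
  assumes "is_pushout A f g p q" "u \<in> Mor A" "v \<in> Mor A" "Cod A u = Cod A v"
    "Dom A u = Cod A f" "Dom A v = Cod A g" "u \<cdot> f = v \<cdot> g"
  obtains w where "w \<in> Mor A" "Dom A w = Cod A q" "Cod A w = Cod A v" "w \<cdot> p = u" "w \<cdot> q = v"
  using ex1_implies_ex[OF pushout_ex1[OF assms]] by (auto simp: homset_iff)

lemma pushout_cancel:
  assumes po: "is_pushout A f g p q" and uv: "u \<in> Mor A" "v \<in> Mor A" "Cod A u = Cod A v"
    "Dom A u = Cod A q" "Dom A v = Cod A q" and eq: "u \<cdot> p = v \<cdot> p" "u \<cdot> q = v \<cdot> q"
  shows "u = v"
proof -
  note D = is_pushoutD[OF po]
  have "v \<cdot> (p \<cdot> f) = v \<cdot> (q \<cdot> g)" by (simp only: D(9))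
  then have "\<exists>!w. w \<in> homset A (Cod A q) (Cod A (v \<cdot> q)) \<and> w \<cdot> p = v \<cdot> p \<and> w \<cdot> q = v \<cdot> q"
    using D(1-8) uv by (intro pushout_ex1[OF po]) simp_all
  moreover have "u \<in> homset A (Cod A q) (Cod A (v \<cdot> q))" "v \<in> homset A (Cod A q) (Cod A (v \<cdot> q))"
    using D(1-8) uv by (simp_all add: homset_iff)
  ultimately show ?thesis using eq by blast
qed

lemma pushout_unique:
  assumes po: "is_pushout A f g p q" and po': "is_pushout A f g p' q'"
  obtains b where "is_iso A b" "b \<in> homset A (Cod A q) (Cod A q')" "b \<cdot> p = p'" "b \<cdot> q = q'"
proof -
  note D = is_pushoutD[OF po] and D' = is_pushoutD[OF po']
  obtain b where b: "b \<in> Mor A" "Dom A b = Cod A q" "Cod A b = Cod A q'" "b \<cdot> p = p'" "b \<cdot> q = q'"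
    using pushout_factor[OF po, of p' q'] D' by metis
  obtain c where c: "c \<in> Mor A" "Dom A c = Cod A q'" "Cod A c = Cod A q" "c \<cdot> p' = p" "c \<cdot> q' = q"
    using pushout_factor[OF po', of p q] D by metis
  have "c \<cdot> b = Id A (Cod A q)"
    by (rule pushout_cancel[OF po]) (use b c D(1-8) in simp_all)
  moreover have "b \<cdot> c = Id A (Cod A q')"
    by (rule pushout_cancel[OF po']) (use b c D'(1-8) in simp_all)
  ultimately have "is_iso A b" using b c by (intro is_isoI[of b _ _ c]) (auto simp: homset_iff)
  with that b show ?thesis by (simp add: homset_iff)
qed

end

text \<open>Only the fields that see direction are turned around, and the result has the type of
  \<open>A\<close>. Hence every result on exact categories can be instantiated at
  \<open>opposite A\<close> and read back in \<open>A\<close> by the simplification rules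
  below.\<close>

definition opposite ::
  "('o, 'm, 'z) exact_category_scheme \<Rightarrow> ('o, 'm, 'z) exact_category_scheme" where
  "opposite A = A\<lparr>Dom := Cod A, Cod := Dom A, Comp := \<lambda>g f. Comp A f g,
     Zero := \<lambda>X Y. Zero A Y X, Conf := (Conf A)\<inverse>\<rparr>"

lemma opposite_sel [simp]:
  "Obj (opposite A) = Obj A" "Mor (opposite A) = Mor A" "Dom (opposite A) = Cod A"
  "Cod (opposite A) = Dom A" "Id (opposite A) = Id A" "Comp (opposite A) g f = Comp A f g"
  "Add (opposite A) = Add A" "Zero (opposite A) X Y = Zero A Y X"
  "Conf (opposite A) = (Conf A)\<inverse>"
  by (simp_all add: opposite_def)

section \<open>Each notion read in the opposite category\<close>

lemma homset_opposite [simp]: "homset (opposite A) X Y = homset A Y X"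
  by (auto simp: homset_def)

lemma is_iso_opposite [simp]: "is_iso (opposite A) = is_iso A"
  by (auto simp: is_iso_def fun_eq_iff)

lemma zero_object_opposite [simp]: "zero_object (opposite A) = zero_object A"
  by (auto simp: zero_object_def fun_eq_iff)

lemma is_pullback_opposite [simp]: "is_pullback (opposite A) = is_pushout A"
  by (simp only: fun_eq_iff is_pullback_def is_pushout_def opposite_sel homset_opposite simp_thms)

lemma is_pushout_opposite [simp]: "is_pushout (opposite A) = is_pullback A"
  by (simp only: fun_eq_iff is_pullback_def is_pushout_def opposite_sel homset_opposite simp_thms)

lemma hom_group_opposite [simp]: "hom_group (opposite A) X Y = hom_group A Y X"
  by (simp add: hom_group_def)

lemma is_biproduct_opposite [simp]:
  "is_biproduct (opposite A) X Y B i1 i2 p1 p2 \<longleftrightarrow> is_biproduct A X Y B p1 p2 i1 i2"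
  by (auto simp: is_biproduct_def)

lemma is_kernel_opposite [simp]: "is_kernel (opposite A) = is_cokernel A"
  by (simp add: is_kernel_def is_cokernel_def fun_eq_iff)

lemma is_cokernel_opposite [simp]: "is_cokernel (opposite A) = is_kernel A"
  by (simp add: is_kernel_def is_cokernel_def fun_eq_iff)

lemma inflations_opposite [simp]: "inflations (opposite A) = deflations A"
  by (simp add: inflations_def deflations_def)

lemma deflations_opposite [simp]: "deflations (opposite A) = inflations A"
  by (simp add: inflations_def deflations_def)

lemma has_lifting_opposite [simp]: "has_lifting (opposite A) i p \<longleftrightarrow> has_lifting A p i"
proof
  assume "has_lifting (opposite A) i p"
  note L = this[unfolded has_lifting_def opposite_sel homset_opposite, rule_format]
  \<comment> \<open>Reversal exchanges the two triangles of a lift and also the two sides of the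
    square equation, hence \<open>sym\<close>.\<close>
  show "has_lifting A p i" unfolding has_lifting_def using L[OF _ _ sym] by blast
next
  assume "has_lifting A p i"
  note L = this[unfolded has_lifting_def, rule_format]
  show "has_lifting (opposite A) i p"
    unfolding has_lifting_def opposite_sel homset_opposite using L[OF _ _ sym] by blast
qed

lemma cofibrant_objects_opposite [simp]:
  "cofibrant_objects (opposite A) M = fibrant_objects A M"
  by (simp add: cofibrant_objects_def fibrant_objects_def)

lemma fibrant_objects_opposite [simp]:
  "fibrant_objects (opposite A) M = cofibrant_objects A M"
  by (simp add: cofibrant_objects_def fibrant_objects_def)

lemma inflations_with_cokernel_in_opposite [simp]:
  "inflations_with_cokernel_in (opposite A) = deflations_with_kernel_in A"
  by (simp add: inflations_with_cokernel_in_def deflations_with_kernel_in_def fun_eq_iff)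

section \<open>Additive and exact categories\<close>

context additive_category
begin

section \<open>Arithmetic in the hom groups\<close>

lemma Zero_simps [simp]:
  assumes "X \<in> Obj A" "Y \<in> Obj A"
  shows "Zero A X Y \<in> Mor A" "Dom A (Zero A X Y) = X" "Cod A (Zero A X Y) = Y"
proof -
  interpret G: comm_group "hom_group A X Y" using hom_comm_group assms .
  have "Zero A X Y \<in> homset A X Y" using G.one_closed by (simp add: hom_group_def)
  then show "Zero A X Y \<in> Mor A" "Dom A (Zero A X Y) = X" "Cod A (Zero A X Y) = Y"
    by (simp_all add: homset_iff)
qed

lemma Add_simps [simp]:
  assumes "f \<in> Mor A" "g \<in> Mor A" "Dom A f = Dom A g" "Cod A f = Cod A g"
  shows "f \<boxplus> g \<in> Mor A" "Dom A (f \<boxplus> g) = Dom A g" "Cod A (f \<boxplus> g) = Cod A g"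
proof -
  interpret G: comm_group "hom_group A (Dom A g) (Cod A g)" using hom_comm_group assms by simp
  have "f \<boxplus> g \<in> homset A (Dom A g) (Cod A g)"
    using G.m_closed[of f g] assms by (simp add: hom_group_def homset_iff)
  then show "f \<boxplus> g \<in> Mor A" "Dom A (f \<boxplus> g) = Dom A g" "Cod A (f \<boxplus> g) = Cod A g"
    by (simp_all add: homset_iff)
qed

lemma Add_Zero [simp]:
  assumes "f \<in> Mor A" "Dom A f = X" "Cod A f = Y"
  shows "f \<boxplus> Zero A X Y = f" "Zero A X Y \<boxplus> f = f"
proof -
  have "X \<in> Obj A" "Y \<in> Obj A" using assms by auto
  then interpret G: comm_group "hom_group A X Y" using hom_comm_group by simp
  show "f \<boxplus> Zero A X Y = f" "Zero A X Y \<boxplus> f = f"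
    using G.r_one[of f] G.l_one[of f] assms by (simp_all add: hom_group_def homset_iff)
qed

lemma Add_commute:
  assumes "f \<in> homset A X Y" "g \<in> homset A X Y"
  shows "f \<boxplus> g = g \<boxplus> f"
proof -
  have "X \<in> Obj A" "Y \<in> Obj A" using assms by (auto simp: homset_iff)
  then interpret G: comm_group "hom_group A X Y" using hom_comm_group by simp
  show ?thesis using G.m_comm[of f g] assms by (simp add: hom_group_def)
qed

lemma Add_left_cancel:
  assumes "f \<in> homset A X Y" "g \<in> homset A X Y" "h \<in> homset A X Y" "f \<boxplus> g = f \<boxplus> h"
  shows "g = h"
proof -
  have "X \<in> Obj A" "Y \<in> Obj A" using assms by (auto simp: homset_iff)
  then interpret G: comm_group "hom_group A X Y" using hom_comm_group by simp
  have "f \<in> Units (hom_group A X Y)" "g \<in> carrier (hom_group A X Y)" "h \<in> carrier (hom_group A X Y)"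
    using assms by (simp_all add: G.Units_eq) (simp_all add: hom_group_def)
  then show ?thesis using G.Units_l_cancel[of f g h] assms(4) by (simp add: hom_group_def)
qed

text \<open>The record has no negation. Where one would subtract, such as in \<open>1 - i r\<close>,
  the later proofs choose a summand by this lemma and compute with it through
  \<open>Add_left_cancel\<close>.\<close>

lemma ex_difference:
  assumes "f \<in> homset A X Y" "g \<in> homset A X Y"
  obtains h where "h \<in> homset A X Y" "f = g \<boxplus> h"
proof -
  have "X \<in> Obj A" "Y \<in> Obj A" using assms by (auto simp: homset_iff)
  then interpret G: comm_group "hom_group A X Y" using hom_comm_group by simp
  let ?h = "inv\<^bsub>hom_group A X Y\<^esub> g \<otimes>\<^bsub>hom_group A X Y\<^esub> f"
  have c: "f \<in> carrier (hom_group A X Y)" "g \<in> carrier (hom_group A X Y)"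
    using assms by (simp_all add: hom_group_def)
  then have "g \<otimes>\<^bsub>hom_group A X Y\<^esub> ?h = f" by (metis G.inv_closed G.l_one G.m_assoc G.r_inv)
  then have "f = g \<boxplus> ?h" by (simp add: hom_group_def)
  moreover have "?h \<in> homset A X Y" using G.m_closed[OF G.inv_closed[OF c(2)] c(1)]
    by (simp add: hom_group_def)
  ultimately show ?thesis using that by blast
qed

lemma Comp_Zero [simp]:
  assumes "h \<in> Mor A" "Dom A h = Y" "X \<in> Obj A"
  shows "h \<cdot> Zero A X Y = Zero A X (Cod A h)"
proof -
  have Y: "Y \<in> Obj A" using assms by auto
  \<comment> \<open>Bilinearity makes the composite equal to its own double; cancelling one copy
    leaves zero.\<close>
  have "h \<cdot> (Zero A X Y \<boxplus> Zero A X Y) = h \<cdot> Zero A X Y \<boxplus> h \<cdot> Zero A X Y"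
    using assms Y by (intro Comp_Add_right) (auto simp: homset_iff)
  then have "h \<cdot> Zero A X Y \<boxplus> h \<cdot> Zero A X Y = h \<cdot> Zero A X Y \<boxplus> Zero A X (Cod A h)"
    using assms Y by simp
  from Add_left_cancel[OF _ _ _ this, of X "Cod A h"] show ?thesis
    using assms Y by (simp add: homset_iff)
qed

lemma Zero_Comp [simp]:
  assumes "h \<in> Mor A" "Cod A h = Y" "Z \<in> Obj A"
  shows "Zero A Y Z \<cdot> h = Zero A (Dom A h) Z"
proof -
  have Y: "Y \<in> Obj A" using assms by auto
  have "(Zero A Y Z \<boxplus> Zero A Y Z) \<cdot> h = Zero A Y Z \<cdot> h \<boxplus> Zero A Y Z \<cdot> h"
    using assms Y by (intro Comp_Add_left) (auto simp: homset_iff)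
  then have "Zero A Y Z \<cdot> h \<boxplus> Zero A Y Z \<cdot> h = Zero A Y Z \<cdot> h \<boxplus> Zero A (Dom A h) Z"
    using assms Y by simp
  from Add_left_cancel[OF _ _ _ this, of "Dom A h" Z] show ?thesis
    using assms Y by (simp add: homset_iff)
qed

lemma Comp_Add [simp]:
  assumes "f \<in> Mor A" "g \<in> Mor A" "h \<in> Mor A" "Dom A f = Dom A g" "Cod A f = Cod A g"
    "Dom A h = Cod A g"
  shows "h \<cdot> (f \<boxplus> g) = h \<cdot> f \<boxplus> h \<cdot> g"
  using assms by (intro Comp_Add_right) (auto simp: homset_iff)

lemma Add_Comp [simp]:
  assumes "f \<in> Mor A" "g \<in> Mor A" "h \<in> Mor A" "Dom A f = Dom A g" "Cod A f = Cod A g"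
    "Cod A h = Dom A g"
  shows "(f \<boxplus> g) \<cdot> h = f \<cdot> h \<boxplus> g \<cdot> h"
  using assms by (intro Comp_Add_left) (auto simp: homset_iff)

section \<open>Kernels, cokernels and zero objects\<close>

lemma is_kernelD:
  assumes "is_kernel A f k"
  shows "f \<in> Mor A" "k \<in> Mor A" "Cod A k = Dom A f" "f \<cdot> k = Zero A (Dom A k) (Cod A f)"
  using assms unfolding is_kernel_def by auto

lemma kernel_factor:
  assumes "is_kernel A f k" "u \<in> Mor A" "Cod A u = Dom A f" "f \<cdot> u = Zero A (Dom A u) (Cod A f)"
  obtains w where "w \<in> Mor A" "Dom A w = Dom A u" "Cod A w = Dom A k" "k \<cdot> w = u"
proof -
  have "u \<in> homset A (Dom A u) (Dom A f)" "Dom A u \<in> Obj A"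
    using assms by (auto simp: homset_iff)
  with assms(1,4) have "\<exists>!w. w \<in> homset A (Dom A u) (Dom A k) \<and> k \<cdot> w = u"
    unfolding is_kernel_def by blast
  then show ?thesis using that by (auto simp: homset_iff)
qed

lemma kernel_cancel:
  assumes "is_kernel A f k" "k \<cdot> u = k \<cdot> v" "u \<in> Mor A" "v \<in> Mor A" "Dom A u = Dom A v"
    "Cod A u = Dom A k" "Cod A v = Dom A k"
  shows "u = v"
proof -
  note k = is_kernelD[OF assms(1)]
  have "f \<cdot> (k \<cdot> v) = Zero A (Dom A v) (Cod A f)"
    using Comp_eq_extend1[OF k(4), of v] assms k by simp
  then have "\<exists>!w. w \<in> homset A (Dom A v) (Dom A k) \<and> k \<cdot> w = k \<cdot> v"
    using assms k unfolding is_kernel_def by (simp add: homset_iff)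
  then show ?thesis using assms by (auto simp: homset_iff)
qed

lemma is_cokernelD:
  assumes "is_cokernel A f c"
  shows "f \<in> Mor A" "c \<in> Mor A" "Dom A c = Cod A f" "c \<cdot> f = Zero A (Dom A f) (Cod A c)"
  using assms unfolding is_cokernel_def by auto

lemma cokernel_factor:
  assumes "is_cokernel A f c" "u \<in> Mor A" "Dom A u = Cod A f" "u \<cdot> f = Zero A (Dom A f) (Cod A u)"
  obtains w where "w \<in> Mor A" "Dom A w = Cod A c" "Cod A w = Cod A u" "w \<cdot> c = u"
proof -
  have "u \<in> homset A (Cod A f) (Cod A u)" "Cod A u \<in> Obj A"
    using assms by (auto simp: homset_iff)
  with assms(1,4) have "\<exists>!w. w \<in> homset A (Cod A c) (Cod A u) \<and> w \<cdot> c = u"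
    unfolding is_cokernel_def by blast
  then show ?thesis using that by (auto simp: homset_iff)
qed

lemma cokernel_cancel:
  assumes "is_cokernel A f c" "u \<cdot> c = v \<cdot> c" "u \<in> Mor A" "v \<in> Mor A" "Cod A u = Cod A v"
    "Dom A u = Cod A c" "Dom A v = Cod A c"
  shows "u = v"
proof -
  note c = is_cokernelD[OF assms(1)]
  have "(v \<cdot> c) \<cdot> f = Zero A (Dom A f) (Cod A v)"
    using assms c by simp
  then have "\<exists>!w. w \<in> homset A (Cod A c) (Cod A v) \<and> w \<cdot> c = v \<cdot> c"
    using assms c unfolding is_cokernel_def by (simp add: homset_iff)
  then show ?thesis using assms by (auto simp: homset_iff)
qed

lemma is_cokernelI:
  assumes "f \<in> Mor A" "c \<in> Mor A" "Dom A c = Cod A f" "c \<cdot> f = Zero A (Dom A f) (Cod A c)"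
    and ex: "\<And>u. \<lbrakk>u \<in> Mor A; Dom A u = Cod A f; u \<cdot> f = Zero A (Dom A f) (Cod A u)\<rbrakk>
      \<Longrightarrow> \<exists>w. w \<in> homset A (Cod A c) (Cod A u) \<and> w \<cdot> c = u"
    and epi: "\<And>u v. \<lbrakk>u \<cdot> c = v \<cdot> c; u \<in> Mor A; v \<in> Mor A; Cod A u = Cod A v;
      Dom A u = Cod A c; Dom A v = Cod A c\<rbrakk> \<Longrightarrow> u = v"
  shows "is_cokernel A f c"
  unfolding is_cokernel_def
proof (intro conjI ballI impI assms(1-4))
  fix T u assume u: "T \<in> Obj A" "u \<in> homset A (Cod A f) T" "u \<cdot> f = Zero A (Dom A f) T"
  then obtain w where w: "w \<in> homset A (Cod A c) T \<and> w \<cdot> c = u"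
    using ex[of u] by (auto simp: homset_iff)
  then show "\<exists>!w. w \<in> homset A (Cod A c) T \<and> w \<cdot> c = u"
  proof (rule ex1I)
    fix v assume "v \<in> homset A (Cod A c) T \<and> v \<cdot> c = u"
    with w show "v = w" by - (rule epi, simp_all add: homset_iff)
  qed
qed

lemma is_kernelI:
  assumes "f \<in> Mor A" "k \<in> Mor A" "Cod A k = Dom A f" "f \<cdot> k = Zero A (Dom A k) (Cod A f)"
    and ex: "\<And>u. \<lbrakk>u \<in> Mor A; Cod A u = Dom A f; f \<cdot> u = Zero A (Dom A u) (Cod A f)\<rbrakk>
      \<Longrightarrow> \<exists>w. w \<in> homset A (Dom A u) (Dom A k) \<and> k \<cdot> w = u"
    and mono: "\<And>u v. \<lbrakk>k \<cdot> u = k \<cdot> v; u \<in> Mor A; v \<in> Mor A; Dom A u = Dom A v;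
      Cod A u = Dom A k; Cod A v = Dom A k\<rbrakk> \<Longrightarrow> u = v"
  shows "is_kernel A f k"
  unfolding is_kernel_def
proof (intro conjI ballI impI assms(1-4))
  fix T u assume u: "T \<in> Obj A" "u \<in> homset A T (Dom A f)" "f \<cdot> u = Zero A T (Cod A f)"
  then obtain w where w: "w \<in> homset A T (Dom A k) \<and> k \<cdot> w = u"
    using ex[of u] by (auto simp: homset_iff)
  then show "\<exists>!w. w \<in> homset A T (Dom A k) \<and> k \<cdot> w = u"
  proof (rule ex1I)
    fix v assume "v \<in> homset A T (Dom A k) \<and> k \<cdot> v = u"
    with w show "v = w" by - (rule mono, simp_all add: homset_iff)
  qed
qed

lemma cokernel_unique:
  assumes "is_cokernel A f c" "is_cokernel A f c'"
  obtains b where "is_iso A b" "b \<in> homset A (Cod A c) (Cod A c')" "b \<cdot> c = c'"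
proof -
  note c = is_cokernelD[OF assms(1)] and c' = is_cokernelD[OF assms(2)]
  obtain b where b: "b \<in> Mor A" "Dom A b = Cod A c" "Cod A b = Cod A c'" "b \<cdot> c = c'"
    using cokernel_factor[OF assms(1), of c'] c' by auto
  obtain a where a: "a \<in> Mor A" "Dom A a = Cod A c'" "Cod A a = Cod A c" "a \<cdot> c' = c"
    using cokernel_factor[OF assms(2), of c] c by auto
  have "a \<cdot> b = Id A (Cod A c)"
    by (rule cokernel_cancel[OF assms(1)]) (use a b c in auto)
  moreover have "b \<cdot> a = Id A (Cod A c')"
    by (rule cokernel_cancel[OF assms(2)]) (use a b c' in auto)
  ultimately show ?thesis using that a b
    by (metis is_isoI homset_iff)
qed

lemma zero_object_unique:
  assumes "zero_object A Z" "f \<in> Mor A" "g \<in> Mor A" "Dom A f = Dom A g" "Cod A f = Cod A g"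
    "Dom A g = Z \<or> Cod A g = Z"
  shows "f = g"
  using assms unfolding zero_object_def by (metis Dom_Obj Cod_Obj homset_iff)

lemma is_biproduct_swap:
  assumes "is_biproduct A X Y B i1 i2 p1 p2"
  shows "is_biproduct A Y X B i2 i1 p2 p1"
  using assms Add_commute[of "i1 \<cdot> p1" B B "i2 \<cdot> p2"] unfolding is_biproduct_def
  by (auto simp: homset_iff)

text \<open>By the universal property, a morphism out of the pushout that kills \<open>i'\<close>
  amounts to a morphism out of \<open>Cod A i\<close> that kills \<open>i\<close>. Both are
  therefore classified by the same object.\<close>

lemma pushout_cokernel:
  assumes po: "is_pushout A i f f' i'" and ck: "is_cokernel A i c"
  obtains c' where "is_cokernel A i' c'" "Cod A c' = Cod A c" "c' \<cdot> f' = c"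
proof -
  note po1 [simp] = is_pushoutD(1-8)[OF po] and c [simp] = is_cokernelD[OF ck]
  obtain c' where c' [simp]: "c' \<in> Mor A" "Dom A c' = Cod A i'" "Cod A c' = Cod A c"
    "c' \<cdot> f' = c" "c' \<cdot> i' = Zero A (Cod A f) (Cod A c)"
    using pushout_factor[OF po, of c "Zero A (Cod A f) (Cod A c)"] by auto
  have "is_cokernel A i' c'"
  proof (rule is_cokernelI)
    show "c' \<cdot> i' = Zero A (Dom A i') (Cod A c')" using c' by simp
  next
    fix u assume u [simp]: "u \<in> Mor A" "Dom A u = Cod A i'" "u \<cdot> i' = Zero A (Dom A i') (Cod A u)"
    have "u \<cdot> (f' \<cdot> i) = u \<cdot> (i' \<cdot> f)" by (simp only: is_pushoutD(9)[OF po])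
    then have "(u \<cdot> f') \<cdot> i = Zero A (Dom A i) (Cod A u)"
      using Comp_eq_extend1[OF u(3), of f] by simp
    then obtain w where w [simp]: "w \<in> Mor A" "Dom A w = Cod A c" "Cod A w = Cod A u" "w \<cdot> c = u \<cdot> f'"
      using cokernel_factor[OF ck, of "u \<cdot> f'"] by auto
    have "w \<cdot> c' = u" by (rule pushout_cancel[OF po]) simp_all
    then show "\<exists>w. w \<in> homset A (Cod A c') (Cod A u) \<and> w \<cdot> c' = u"
      by (intro exI[of _ w]) (simp add: homset_iff)
  next
    fix u v assume uv [simp]: "u \<in> Mor A" "v \<in> Mor A" "Cod A u = Cod A v" "Dom A u = Cod A c'"
      "Dom A v = Cod A c'" and eq: "u \<cdot> c' = v \<cdot> c'"
    show "u = v"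
    proof (rule cokernel_cancel[OF ck])
      show "u \<cdot> c = v \<cdot> c" using Comp_eq_extend[OF eq, of f'] by simp
    qed auto
  qed auto
  with that c' show ?thesis by simp
qed

end

section \<open>Conflations and the opposite exact structure\<close>

context exact_category
begin

text \<open>Cokernels are unique up to isomorphism and \<open>Conf\<close> is closed under
  isomorphism. This is the standard way below to recognise a deflation: exhibit it as a cokernel of
  an inflation.\<close>

lemma inflation_cokernel:
  assumes "i \<in> inflations A" "is_cokernel A i c"
  shows "(i, c) \<in> Conf A"
proof -
  obtain d where d: "(i, d) \<in> Conf A" using assms(1) by (auto simp: inflations_def)
  note i [simp] = is_cokernelD[OF assms(2)] and d' [simp] = is_cokernelD[OF Conf_cokernel[OF d]]
  obtain b where "is_iso A b" "b \<in> homset A (Cod A d) (Cod A c)" "b \<cdot> d = c"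
    using cokernel_unique[OF Conf_cokernel[OF d] assms(2)] .
  then show ?thesis
    using Conf_iso[OF d is_iso_Id[of "Dom A i"] is_iso_Id[of "Cod A i"], of b i c]
    by (auto simp: homset_iff)
qed

lemma exact_category_opposite: "exact_category (opposite A)"
proof (intro exact_category.intro additive_category.intro category.intro
    additive_category_axioms.intro exact_category_axioms.intro)
  fix X Y assume "X \<in> Obj (opposite A)" "Y \<in> Obj (opposite A)"
  then show "\<exists>B i1 i2 p1 p2. is_biproduct (opposite A) X Y B i1 i2 p1 p2"
    using ex_biproduct[of X Y] by simp blast
next
  fix i d a b c i' d'
  assume "(i, d) \<in> Conf (opposite A)" "is_iso (opposite A) a" "is_iso (opposite A) b"
    "is_iso (opposite A) c" "Dom (opposite A) a = Dom (opposite A) i"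
    "Dom (opposite A) b = Cod (opposite A) i" "Dom (opposite A) c = Cod (opposite A) d"
    "i' \<in> homset (opposite A) (Cod (opposite A) a) (Cod (opposite A) b)"
    "d' \<in> homset (opposite A) (Cod (opposite A) b) (Cod (opposite A) c)"
    "b \<cdot>\<^bsub>opposite A\<^esub> i = i' \<cdot>\<^bsub>opposite A\<^esub> a" "c \<cdot>\<^bsub>opposite A\<^esub> d = d' \<cdot>\<^bsub>opposite A\<^esub> b"
  then have *: "(d, i) \<in> Conf A" "is_iso A a" "is_iso A b" "is_iso A c" "Cod A a = Cod A i"
    "Cod A b = Dom A i" "Cod A c = Dom A d" "i' \<in> homset A (Dom A b) (Dom A a)"
    "d' \<in> homset A (Dom A c) (Dom A b)" "i \<cdot> b = a \<cdot> i'" "d \<cdot> c = b \<cdot> d'"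
    by simp_all
  \<comment> \<open>Reversing arrows turns the given isomorphism of sequences around, so
    \<open>Conf_iso\<close> is applied to the inverses, with the two outer ones exchanged. The
    remaining axioms are self-dual as they stand.\<close>
  obtain a' where a': "a' \<in> homset A (Cod A a) (Dom A a)" "a' \<cdot> a = Id A (Dom A a)"
    "a \<cdot> a' = Id A (Cod A a)" "is_iso A a'" using is_isoE[OF *(2)] .
  obtain b' where b': "b' \<in> homset A (Cod A b) (Dom A b)" "b' \<cdot> b = Id A (Dom A b)"
    "b \<cdot> b' = Id A (Cod A b)" "is_iso A b'" using is_isoE[OF *(3)] .
  obtain c' where c': "c' \<in> homset A (Cod A c) (Dom A c)" "c' \<cdot> c = Id A (Dom A c)"
    "c \<cdot> c' = Id A (Cod A c)" "is_iso A c'" using is_isoE[OF *(4)] .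
  have mor: "a \<in> Mor A" "b \<in> Mor A" "c \<in> Mor A" using *(2-4) by (auto simp: is_iso_def)
  note di = is_kernelD(1-3)[OF Conf_kernel[OF *(1)]]
  have t [simp]: "a' \<in> Mor A" "Dom A a' = Cod A a" "Cod A a' = Dom A a" "b' \<in> Mor A"
    "Dom A b' = Cod A b" "Cod A b' = Dom A b" "c' \<in> Mor A" "Dom A c' = Cod A c" "Cod A c' = Dom A c"
    "i' \<in> Mor A" "Dom A i' = Dom A b" "Cod A i' = Dom A a"
    "d' \<in> Mor A" "Dom A d' = Dom A c" "Cod A d' = Dom A b"
    using a' b' c' *(8,9) by (simp_all add: homset_iff)
  note [simp] = di mor *(5-7)
  have "b' \<cdot> d = b' \<cdot> (d \<cdot> (c \<cdot> c'))" by (simp add: c'(3))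
  also have "\<dots> = b' \<cdot> (b \<cdot> (d' \<cdot> c'))"
    using Comp_eq_extend[OF *(11), of c'] by simp
  also have "\<dots> = d' \<cdot> c'"
    using Comp_eq_extend1[OF b'(2), of "d' \<cdot> c'"] by simp
  finally have 1: "b' \<cdot> d = d' \<cdot> c'" .
  have "a' \<cdot> i = a' \<cdot> (i \<cdot> (b \<cdot> b'))" by (simp add: b'(3))
  also have "\<dots> = a' \<cdot> (a \<cdot> (i' \<cdot> b'))"
    using Comp_eq_extend[OF *(10), of b'] by simp
  also have "\<dots> = i' \<cdot> b'"
    using Comp_eq_extend1[OF a'(2), of "i' \<cdot> b'"] by simp
  finally have 2: "a' \<cdot> i = i' \<cdot> b'" .
  have "(d', i') \<in> Conf A"
    using Conf_iso[OF *(1) c'(4) b'(4) a'(4), of d' i'] 1 2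
    by (simp add: homset_iff)
  then show "(i', d') \<in> Conf (opposite A)" by simp
qed (use ex_zero_object Dom_Obj Cod_Obj hom_comm_group Conf_kernel Conf_cokernel Id_inflation Id_deflation
  inflation_Comp deflation_Comp inflation_pushout deflation_pullback in \<open>auto simp: homset_iff\<close>)


lemma ConfD:
  assumes "(i, d) \<in> Conf A"
  shows "i \<in> Mor A" "d \<in> Mor A" "Dom A d = Cod A i" "d \<cdot> i = Zero A (Dom A i) (Cod A d)"
  using is_cokernelD[OF Conf_cokernel[OF assms]] .

lemma deflation_Mor: "d \<in> deflations A \<Longrightarrow> d \<in> Mor A"
  by (auto simp: deflations_def dest: ConfD)

lemma iso_Comp_inflation:
  assumes "i \<in> inflations A" "is_iso A b" "Dom A b = Cod A i"
  shows "b \<cdot> i \<in> inflations A"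
proof -
  obtain d where id: "(i, d) \<in> Conf A" using assms(1) by (auto simp: inflations_def)
  obtain b' where b': "b' \<in> homset A (Cod A b) (Dom A b)" "b' \<cdot> b = Id A (Dom A b)"
    using is_isoE[OF assms(2)] by metis
  have [simp]: "b \<in> Mor A" "b' \<in> Mor A" "Dom A b' = Cod A b" "Cod A b' = Dom A b"
    using b' assms(2) by (auto simp: homset_iff is_iso_def)
  note [simp] = ConfD(1-3)[OF id] assms(3) b'(2)
  have "(b \<cdot> i, d \<cdot> b') \<in> Conf A"
    using Conf_iso[OF id is_iso_Id[of "Dom A i"] assms(2) is_iso_Id[of "Cod A d"], of "b \<cdot> i" "d \<cdot> b'"]
    by (simp add: homset_iff)
  then show ?thesis by (auto simp: inflations_def)
qed

text \<open>The identity of \<open>X\<close> is an inflation by axiom, and the morphism from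
  \<open>X\<close> to zero is its cokernel.\<close>

lemma Zero_deflation:
  assumes "zero_object A Z" "X \<in> Obj A"
  shows "Zero A X Z \<in> deflations A"
proof -
  have [simp]: "Z \<in> Obj A" using assms by (simp add: zero_object_def)
  have "is_cokernel A (Id A X) (Zero A X Z)"
  proof (rule is_cokernelI)
    fix u assume "u \<in> Mor A" "Dom A u = Cod A (Id A X)"
      "u \<cdot> Id A X = Zero A (Dom A (Id A X)) (Cod A u)"
    then show "\<exists>w. w \<in> homset A (Cod A (Zero A X Z)) (Cod A u) \<and> w \<cdot> Zero A X Z = u"
      using assms(2) by (intro exI[of _ "Zero A Z (Cod A u)"]) (simp add: homset_iff)
  next
    fix u v assume "u \<in> Mor A" "v \<in> Mor A" "Cod A u = Cod A v" "Dom A u = Cod A (Zero A X Z)"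
      "Dom A v = Cod A (Zero A X Z)"
    then show "u = v" using assms zero_object_unique[OF assms(1), of u v] by simp
  qed (use assms in simp_all)
  from inflation_cokernel[OF Id_inflation[OF assms(2)] this] show ?thesis
    by (auto simp: deflations_def)
qed

lemma Zero_inflation:
  assumes "zero_object A Z" "X \<in> Obj A"
  shows "Zero A Z X \<in> inflations A"
proof -
  interpret op: exact_category "opposite A" by (rule exact_category_opposite)
  show ?thesis using op.Zero_deflation[of Z X] assms by simp
qed

section \<open>Biproducts and split conflations\<close>

lemma is_biproductD:
  assumes "is_biproduct A X Y B i1 i2 p1 p2"
  shows "X \<in> Obj A" "Y \<in> Obj A" "B \<in> Obj A"
    "i1 \<in> Mor A" "Dom A i1 = X" "Cod A i1 = B" "i2 \<in> Mor A" "Dom A i2 = Y" "Cod A i2 = B"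
    "p1 \<in> Mor A" "Dom A p1 = B" "Cod A p1 = X" "p2 \<in> Mor A" "Dom A p2 = B" "Cod A p2 = Y"
    "p1 \<cdot> i1 = Id A X" "p2 \<cdot> i2 = Id A Y" "p2 \<cdot> i1 = Zero A X Y" "p1 \<cdot> i2 = Zero A Y X"
    "i1 \<cdot> p1 \<boxplus> i2 \<cdot> p2 = Id A B"
  using assms unfolding is_biproduct_def by (auto simp: homset_iff)

lemma biproduct_eqI:
  assumes bp: "is_biproduct A X Y B i1 i2 p1 p2"
    and uv: "u \<in> Mor A" "v \<in> Mor A" "Dom A u = B" "Dom A v = B" "Cod A u = Cod A v"
    and eq: "u \<cdot> i1 = v \<cdot> i1" "u \<cdot> i2 = v \<cdot> i2"
  shows "u = v"
proof -
  note D [simp] = is_biproductD(1-15)[OF bp] and [simp] = uv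
  have "u = u \<cdot> (i1 \<cdot> p1 \<boxplus> i2 \<cdot> p2)" using is_biproductD(20)[OF bp] by simp
  also have "\<dots> = v \<cdot> (i1 \<cdot> p1 \<boxplus> i2 \<cdot> p2)"
    using Comp_eq_extend[OF eq(1), of p1] Comp_eq_extend[OF eq(2), of p2] by simp
  also have "\<dots> = v" using is_biproductD(20)[OF bp] by simp
  finally show ?thesis .
qed

text \<open>Split sequences are not conflations by axiom. A biproduct is a pushout of the inflation
  from zero to \<open>Y\<close> along the morphism from zero to \<open>X\<close>, so its injection
  \<open>i1\<close> is an inflation, and \<open>p2\<close> is a cokernel of it.\<close>

lemma biproduct_Conf:
  assumes bp: "is_biproduct A X Y B i1 i2 p1 p2"
  shows "(i1, p2) \<in> Conf A"
proof -
  note D [simp] = is_biproductD(1-19)[OF bp]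
  obtain Z where Z: "zero_object A Z" using ex_zero_object by blast
  then have [simp]: "Z \<in> Obj A" by (simp add: zero_object_def)
  obtain f' i' where po: "is_pushout A (Zero A Z Y) (Zero A Z X) f' i'" and i': "i' \<in> inflations A"
    using inflation_pushout[OF Zero_inflation[OF Z D(2)], of "Zero A Z X"] by auto
  have "is_pushout A (Zero A Z Y) (Zero A Z X) i2 i1"
    unfolding is_pushout_def
  proof (intro conjI ballI impI)
    fix T u v assume T: "T \<in> Obj A" "u \<in> homset A (Cod A (Zero A Z Y)) T"
      "v \<in> homset A (Cod A (Zero A Z X)) T"
    then have [simp]: "u \<in> Mor A" "Dom A u = Y" "Cod A u = T" "v \<in> Mor A" "Dom A v = X" "Cod A v = T"
      by (simp_all add: homset_iff)
    show "\<exists>!w. w \<in> homset A (Cod A i2) T \<and> w \<cdot> i2 = u \<and> w \<cdot> i1 = v"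
    proof (rule ex1I[of _ "v \<cdot> p1 \<boxplus> u \<cdot> p2"])
      show "v \<cdot> p1 \<boxplus> u \<cdot> p2 \<in> homset A (Cod A i2) T \<and> (v \<cdot> p1 \<boxplus> u \<cdot> p2) \<cdot> i2 = u \<and>
        (v \<cdot> p1 \<boxplus> u \<cdot> p2) \<cdot> i1 = v"
        using T(1) by (simp add: homset_iff)
      fix w assume "w \<in> homset A (Cod A i2) T \<and> w \<cdot> i2 = u \<and> w \<cdot> i1 = v"
      then show "w = v \<cdot> p1 \<boxplus> u \<cdot> p2"
        using T(1) by - (rule biproduct_eqI[OF bp], simp_all add: homset_iff)
    qed
  qed simp_all
  then obtain b where "is_iso A b" "b \<in> homset A (Cod A i') (Cod A i1)" "b \<cdot> i' = i1"
    using pushout_unique[OF po] by metis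
  then have i1: "i1 \<in> inflations A" using iso_Comp_inflation[OF i', of b] by (simp add: homset_iff)
  have "is_cokernel A i1 p2"
  proof (rule is_cokernelI)
    fix u assume [simp]: "u \<in> Mor A" "Dom A u = Cod A i1" "u \<cdot> i1 = Zero A (Dom A i1) (Cod A u)"
    have "(u \<cdot> i2) \<cdot> p2 = u" by (rule biproduct_eqI[OF bp]) simp_all
    then show "\<exists>w. w \<in> homset A (Cod A p2) (Cod A u) \<and> w \<cdot> p2 = u"
      by (intro exI[of _ "u \<cdot> i2"]) (simp add: homset_iff)
  next
    fix u v assume [simp]: "u \<in> Mor A" "v \<in> Mor A" "Cod A u = Cod A v" "Dom A u = Cod A p2"
      "Dom A v = Cod A p2" and "u \<cdot> p2 = v \<cdot> p2"
    from Comp_eq_extend[OF this(6), of i2] show "u = v" by simp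
  qed simp_all
  with i1 show ?thesis by (rule inflation_cokernel)
qed

lemma split_inflation:
  assumes id: "(i, d) \<in> Conf A" and r: "r \<in> homset A (Cod A i) (Dom A i)" "r \<cdot> i = Id A (Dom A i)"
  obtains s where "is_biproduct A (Dom A i) (Cod A d) (Cod A i) i s r d"
proof -
  note [simp] = ConfD[OF id] r(2)
  have [simp]: "r \<in> Mor A" "Dom A r = Cod A i" "Cod A r = Dom A i"
    using r by (simp_all add: homset_iff)
  \<comment> \<open>\<open>t\<close> is the complementary idempotent \<open>1 - i r\<close>. It
    kills \<open>i\<close>, so it factors through the cokernel as \<open>s \<cdot> d\<close>, and
    this \<open>s\<close> is the missing injection.\<close>
  obtain t where t: "t \<in> homset A (Cod A i) (Cod A i)" "Id A (Cod A i) = i \<cdot> r \<boxplus> t"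
    using ex_difference[of "Id A (Cod A i)" "Cod A i" "Cod A i" "i \<cdot> r"] by (auto simp: homset_iff)
  have [simp]: "t \<in> Mor A" "Dom A t = Cod A i" "Cod A t = Cod A i"
    using t(1) by (simp_all add: homset_iff)
  have "i \<boxplus> t \<cdot> i = (i \<cdot> r \<boxplus> t) \<cdot> i" by simp
  also have "\<dots> = i \<boxplus> Zero A (Dom A i) (Cod A i)" unfolding t(2)[symmetric] by simp
  finally have ti: "t \<cdot> i = Zero A (Dom A i) (Cod A i)"
    by (rule Add_left_cancel[rotated 3]) (simp_all add: homset_iff)
  have "r \<boxplus> r \<cdot> t = r \<cdot> (i \<cdot> r \<boxplus> t)" using Comp_eq_extend1[OF r(2), of r] by simp
  also have "\<dots> = r \<boxplus> Zero A (Cod A i) (Dom A i)" unfolding t(2)[symmetric] by simp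
  finally have rt: "r \<cdot> t = Zero A (Cod A i) (Dom A i)"
    by (rule Add_left_cancel[rotated 3]) (simp_all add: homset_iff)
  have "d = d \<cdot> (i \<cdot> r \<boxplus> t)" unfolding t(2)[symmetric] by simp
  also have "\<dots> = d \<cdot> t" using Comp_eq_extend1[OF ConfD(4)[OF id], of r] by simp
  finally have dt: "d \<cdot> t = d" by simp
  obtain s where s [simp]: "s \<in> Mor A" "Dom A s = Cod A d" "Cod A s = Cod A i" "s \<cdot> d = t"
    using cokernel_factor[OF Conf_cokernel[OF id], of t] ti by auto
  have "r \<cdot> s = Zero A (Cod A d) (Dom A i)"
    by (rule cokernel_cancel[OF Conf_cokernel[OF id]]) (simp_all add: rt)
  moreover have "d \<cdot> s = Id A (Cod A d)"
    by (rule cokernel_cancel[OF Conf_cokernel[OF id]]) (simp_all add: dt)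
  ultimately have "is_biproduct A (Dom A i) (Cod A d) (Cod A i) i s r d"
    unfolding is_biproduct_def using t(2) by (simp add: homset_iff)
  with that show ?thesis .
qed

lemma split_deflation:
  assumes "(i, d) \<in> Conf A" "s \<in> homset A (Cod A d) (Dom A d)" "d \<cdot> s = Id A (Cod A d)"
  obtains r where "is_biproduct A (Dom A i) (Cod A d) (Cod A i) i s r d"
proof -
  interpret op: exact_category "opposite A" by (rule exact_category_opposite)
  obtain r where "is_biproduct (opposite A) (Cod A d) (Dom A i) (Dom A d) d r s i"
    using op.split_inflation[of d i s] assms by auto
  then have "is_biproduct A (Cod A d) (Dom A i) (Cod A i) s i d r"
    using ConfD[OF assms(1)] by simp
  with that show ?thesis using is_biproduct_swap by blast
qed

text \<open>Both sides amount to a biproduct decomposition of the middle term. This is what makes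
  the vanishing of \<open>Ext1\<close> self-dual.\<close>

lemma split_conflation_iff:
  assumes "(i, d) \<in> Conf A"
  shows "(\<exists>r \<in> homset A (Cod A i) (Dom A i). r \<cdot> i = Id A (Dom A i)) \<longleftrightarrow>
    (\<exists>s \<in> homset A (Cod A d) (Dom A d). d \<cdot> s = Id A (Cod A d))"
proof -
  note D = ConfD(3)[OF assms]
  show ?thesis
  proof (intro iffI; elim bexE)
    fix r assume "r \<in> homset A (Cod A i) (Dom A i)" "r \<cdot> i = Id A (Dom A i)"
    then obtain s where "is_biproduct A (Dom A i) (Cod A d) (Cod A i) i s r d"
      using split_inflation[OF assms] by blast
    from is_biproductD[OF this] show "\<exists>s \<in> homset A (Cod A d) (Dom A d). d \<cdot> s = Id A (Cod A d)"
      using D by (intro bexI[of _ s]) (simp_all add: homset_iff)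
  next
    fix s assume "s \<in> homset A (Cod A d) (Dom A d)" "d \<cdot> s = Id A (Cod A d)"
    then obtain r where "is_biproduct A (Dom A i) (Cod A d) (Cod A i) i s r d"
      using split_deflation[OF assms] by blast
    from is_biproductD[OF this] show "\<exists>r \<in> homset A (Cod A i) (Dom A i). r \<cdot> i = Id A (Dom A i)"
      by (intro bexI[of _ r]) (simp_all add: homset_iff)
  qed
qed


section \<open>Vanishing of Yoneda Ext as splitting of conflations\<close>

lemma split_extensions_equiv:
  assumes bp: "is_biproduct A Y X B i1 i2 p1 p2" and bp': "is_biproduct A Y X B' i1' i2' p1' p2'"
  shows "((i1, p2), (i1', p2')) \<in> extension_equiv A X Y"
proof -
  note D [simp] = is_biproductD(1-19)[OF bp] and D' [simp] = is_biproductD(1-19)[OF bp']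
  let ?b = "i1' \<cdot> p1 \<boxplus> i2' \<cdot> p2" and ?b' = "i1 \<cdot> p1' \<boxplus> i2 \<cdot> p2'"
  have "?b' \<cdot> ?b = Id A B"
    using Comp_eq_extend1[OF D'(16), of p1] Comp_eq_extend1[OF D'(17), of p2]
      Comp_eq_extend1[OF D'(18), of p1] Comp_eq_extend1[OF D'(19), of p2] is_biproductD(20)[OF bp]
    by simp
  moreover have "?b \<cdot> ?b' = Id A B'"
    using Comp_eq_extend1[OF D(16), of p1'] Comp_eq_extend1[OF D(17), of p2']
      Comp_eq_extend1[OF D(18), of p1'] Comp_eq_extend1[OF D(19), of p2'] is_biproductD(20)[OF bp']
    by simp
  ultimately have "is_iso A ?b" by (intro is_isoI[of ?b B B' ?b']) (simp_all add: homset_iff)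
  moreover have "?b \<cdot> i1 = i1'" by simp
  moreover have "p2' \<cdot> ?b = p2"
    using Comp_eq_extend1[OF D'(17), of p2] Comp_eq_extend1[OF D'(18), of p1] by simp
  ultimately show ?thesis
    using biproduct_Conf[OF bp] biproduct_Conf[OF bp']
    unfolding extension_equiv_def extensions_def
    by (auto simp: homset_iff intro!: bexI[of _ ?b])
qed

text \<open>The neutral class consists of the extensions equivalent to a biproduct, and a retraction
  can be carried along an equivalence; conversely all split extensions are equivalent to each other.
  Later proofs work with retractions instead of extension classes.\<close>

lemma Ext1_trivial_iff:
  assumes X: "X \<in> Obj A" and Y: "Y \<in> Obj A"
  shows "Ext1 A X Y = {Ext1_zero A X Y} \<longleftrightarrow>
    (\<forall>(i, d) \<in> extensions A X Y. \<exists>r \<in> homset A (Cod A i) Y. r \<cdot> i = Id A Y)"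
proof
  assume triv: "Ext1 A X Y = {Ext1_zero A X Y}"
  show "\<forall>(i, d) \<in> extensions A X Y. \<exists>r \<in> homset A (Cod A i) Y. r \<cdot> i = Id A Y"
  proof clarify
    fix i d assume id: "(i, d) \<in> extensions A X Y"
    then have id' [simp]: "(i, d) \<in> Conf A" "Dom A i = Y" "Cod A d = X"
      by (auto simp: extensions_def)
    note [simp] = ConfD[OF id'(1)]
    have "((i, d), (i, d)) \<in> extension_equiv A X Y"
      unfolding extension_equiv_def using id is_iso_Id[of "Cod A i"]
      by (auto simp: homset_iff intro!: bexI[of _ "Id A (Cod A i)"])
    moreover have "extension_equiv A X Y `` {(i, d)} = Ext1_zero A X Y"
      using triv quotientI[OF id, of "extension_equiv A X Y"] unfolding Ext1_def by simp
    ultimately have "(i, d) \<in> Ext1_zero A X Y" by blast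
    then obtain B i1 i2 p1 p2 where bp: "is_biproduct A Y X B i1 i2 p1 p2"
      and e: "((i1, p2), (i, d)) \<in> extension_equiv A X Y"
      unfolding Ext1_zero_def by blast
    from e obtain b where b: "is_iso A b" "b \<in> homset A B (Cod A i)" "b \<cdot> i1 = i"
      using is_biproductD(6)[OF bp] unfolding extension_equiv_def by auto
    note [simp] = is_biproductD(1-19)[OF bp]
    obtain b' where b': "b' \<in> homset A (Cod A b) (Dom A b)" "b' \<cdot> b = Id A (Dom A b)"
      using is_isoE[OF b(1)] by metis
    have [simp]: "b \<in> Mor A" "Dom A b = B" "Cod A b = Cod A i" "b' \<in> Mor A" "Dom A b' = Cod A i"
      "Cod A b' = B"
      using b b' by (simp_all add: homset_iff)
    have "b' \<cdot> (b \<cdot> i1) = i1" using Comp_eq_extend1[OF b'(2), of i1] by simp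
    then have "(p1 \<cdot> b') \<cdot> i = Id A Y" using b(3) by simp
    then show "\<exists>r \<in> homset A (Cod A i) Y. r \<cdot> i = Id A Y"
      by (intro bexI[of _ "p1 \<cdot> b'"]) (simp_all add: homset_iff)
  qed
next
  assume split: "\<forall>(i, d) \<in> extensions A X Y. \<exists>r \<in> homset A (Cod A i) Y. r \<cdot> i = Id A Y"
  have bp: "\<exists>s r B. is_biproduct A Y X B i s r d" if "(i, d) \<in> extensions A X Y" for i d
  proof -
    have id: "(i, d) \<in> Conf A" "Dom A i = Y" "Cod A d = X" using that by (auto simp: extensions_def)
    from split that obtain r where "r \<in> homset A (Cod A i) Y" "r \<cdot> i = Id A Y" by blast
    with id(2) obtain s where "is_biproduct A (Dom A i) (Cod A d) (Cod A i) i s r d"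
      using split_inflation[OF id(1), of r] by blast
    then show ?thesis using id by blast
  qed
  have equiv: "(e, e') \<in> extension_equiv A X Y"
    if "e \<in> extensions A X Y" "e' \<in> extensions A X Y" for e e'
    using bp[of "fst e" "snd e"] bp[of "fst e'" "snd e'"] that split_extensions_equiv
    by (metis prod.collapse)
  have sub: "extension_equiv A X Y \<subseteq> extensions A X Y \<times> extensions A X Y"
    by (auto simp: extension_equiv_def)
  \<comment> \<open>The biproduct shows that the set of extensions is nonempty, so the quotient is
    exactly one class rather than empty.\<close>
  obtain B i1 i2 p1 p2 where B: "is_biproduct A Y X B i1 i2 p1 p2"
    using ex_biproduct[OF Y X] by blast
  then have ne: "(i1, p2) \<in> extensions A X Y"
    using biproduct_Conf[OF B] is_biproductD[OF B] by (simp add: extensions_def)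
  have cls: "extension_equiv A X Y `` {e} = extensions A X Y" if "e \<in> extensions A X Y" for e
    using equiv[OF that] sub by blast
  have "Ext1_zero A X Y = extensions A X Y"
    unfolding Ext1_zero_def using B equiv[OF ne] sub by blast
  moreover have "Ext1 A X Y = {extensions A X Y}"
    unfolding Ext1_def quotient_def using cls ne by auto
  ultimately show "Ext1 A X Y = {Ext1_zero A X Y}" by simp
qed

lemma Ext1_vanishes_iff:
  assumes "\<C> \<subseteq> Obj A" "\<D> \<subseteq> Obj A"
  shows "Ext1_vanishes A \<C> \<D> \<longleftrightarrow> (\<forall>i d. (i, d) \<in> Conf A \<longrightarrow> Cod A d \<in> \<C> \<longrightarrow> Dom A i \<in> \<D> \<longrightarrow>
    (\<exists>r \<in> homset A (Cod A i) (Dom A i). r \<cdot> i = Id A (Dom A i)))"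
proof -
  have "Ext1_vanishes A \<C> \<D> \<longleftrightarrow> (\<forall>X \<in> \<C>. \<forall>Y \<in> \<D>.
    \<forall>(i, d) \<in> extensions A X Y. \<exists>r \<in> homset A (Cod A i) Y. r \<cdot> i = Id A Y)"
    unfolding Ext1_vanishes_def using assms by (simp add: Ext1_trivial_iff subset_iff)
  then show ?thesis by (simp add: extensions_def) blast
qed

lemma Ext1_vanishes_opposite:
  assumes "\<C> \<subseteq> Obj A" "\<D> \<subseteq> Obj A"
  shows "Ext1_vanishes (opposite A) \<D> \<C> \<longleftrightarrow> Ext1_vanishes A \<C> \<D>"
proof -
  interpret op: exact_category "opposite A" by (rule exact_category_opposite)
  show ?thesis
    using split_conflation_iff ConfD(3)
    by (simp add: Ext1_vanishes_iff[OF assms] op.Ext1_vanishes_iff assms) blast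
qed

lemma Ext1_trivial_opposite_iff:
  assumes "X \<in> Obj A" "Y \<in> Obj A"
  shows "Ext1 (opposite A) Y X = {Ext1_zero (opposite A) Y X} \<longleftrightarrow> Ext1 A X Y = {Ext1_zero A X Y}"
  using Ext1_vanishes_opposite[of "{X}" "{Y}"] assms by (simp add: Ext1_vanishes_def)

text \<open>The definition speaks of split epimorphisms only, while its dual asks that a split
  monomorphism \<open>i\<close> be an inflation. A retraction \<open>r\<close> of \<open>i\<close>
  is a split epimorphism, hence a deflation with some kernel \<open>k\<close>; then \<open>k\<close>
  and \<open>i\<close> are the two injections of a biproduct.\<close>

lemma weakly_idempotent_complete_opposite:
  assumes "weakly_idempotent_complete A"
  shows "weakly_idempotent_complete (opposite A)"
  unfolding weakly_idempotent_complete_def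
proof (intro allI impI)
  fix i assume "split_epi (opposite A) i"
  then obtain r where [simp]: "i \<in> Mor A" and r: "r \<in> homset A (Cod A i) (Dom A i)"
    "r \<cdot> i = Id A (Dom A i)" unfolding split_epi_def by auto
  then have [simp]: "r \<in> Mor A" "Dom A r = Cod A i" "Cod A r = Dom A i"
    by (simp_all add: homset_iff)
  have "split_epi A r" unfolding split_epi_def using r
    by (auto simp: homset_iff intro!: bexI[of _ i])
  then obtain k where k: "(k, r) \<in> Conf A"
    using assms by (auto simp: weakly_idempotent_complete_def deflations_def)
  obtain q where "is_biproduct A (Dom A k) (Cod A r) (Cod A k) k i q r"
    using split_deflation[OF k, of i] r by (auto simp: homset_iff)
  then have "(i, q) \<in> Conf A" using biproduct_Conf is_biproduct_swap by blast
  then show "i \<in> deflations (opposite A)" by (auto simp: inflations_def)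
qed

text \<open>
  The pullback \<open>P\<close> of \<open>p \<cdot> s\<close> along \<open>p\<close> is split over the domain of \<open>s\<close>, which provides a kernel
  of \<open>p\<close>; this kernel is a pushout of the kernel of \<open>P \<rightarrow> Cod p\<close>.
\<close>

lemma deflation_right_factor:
  assumes wic: "weakly_idempotent_complete A"
    and p [simp]: "p \<in> Mor A" and s [simp]: "s \<in> Mor A" "Cod A s = Dom A p"
    and ps: "p \<cdot> s \<in> deflations A"
  shows "p \<in> deflations A"
proof -
  interpret op: exact_category "opposite A" by (rule exact_category_opposite)
  obtain p' d' where pb: "is_pullback A (p \<cdot> s) p p' d'" and d': "d' \<in> deflations A"
    using deflation_pullback[OF ps, of p] by auto
  \<comment> \<open>Pullbacks are handled by the pushout rules of the opposite category.\<close>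
  note op_pb = pb[folded is_pushout_opposite]
  define P where "P = Dom A d'"
  have pbD [simp]: "p' \<in> Mor A" "d' \<in> Mor A" "Dom A p' = P" "Dom A d' = P" "Cod A p' = Dom A s"
    "Cod A d' = Dom A p" "P \<in> Obj A"
    using op.is_pushoutD(4-8)[OF op_pb] unfolding P_def by simp_all
  have sq: "p \<cdot> (s \<cdot> p') = p \<cdot> d'" using op.is_pushoutD(9)[OF op_pb] by simp
  \<comment> \<open>The identity of \<open>Dom A s\<close> and \<open>s\<close> itself agree after
    mapping to \<open>Cod A p\<close>, so together they define a section of
    \<open>p'\<close>.\<close>
  obtain t where t [simp]: "t \<in> Mor A" "Dom A t = Dom A s" "Cod A t = P"
    "p' \<cdot> t = Id A (Dom A s)" "d' \<cdot> t = s"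
    using op.pushout_factor[OF op_pb, of "Id A (Dom A s)" s] by auto
  have "split_epi A p'" unfolding split_epi_def
    by (auto simp: homset_iff intro!: bexI[of _ t])
  then have p': "p' \<in> deflations A" using wic by (simp add: weakly_idempotent_complete_def)
  then obtain k where k: "(k, p') \<in> Conf A" by (auto simp: deflations_def)
  obtain n where n: "(n, d') \<in> Conf A" using d' by (auto simp: deflations_def)
  have [simp]: "k \<in> Mor A" "Cod A k = P" "p' \<cdot> k = Zero A (Dom A k) (Dom A s)"
    "n \<in> Mor A" "Cod A n = P" "d' \<cdot> n = Zero A (Dom A n) (Dom A p)"
    using ConfD[OF k] ConfD[OF n] by simp_all
  \<comment> \<open>The diagonal of the square equals \<open>(p \<cdot> s) \<cdot> p'\<close>, a
    composite of two deflations. It therefore has a kernel \<open>l\<close> that is an inflation,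
    although nothing of the kind is known yet for \<open>p\<close>.\<close>
  have "p \<cdot> d' \<in> deflations A" using deflation_Comp[OF p' ps] sq by simp
  then obtain l where l: "(l, p \<cdot> d') \<in> Conf A" by (auto simp: deflations_def)
  have lD [simp]: "l \<in> Mor A" "Cod A l = P" "p \<cdot> (d' \<cdot> l) = Zero A (Dom A l) (Cod A p)"
    using ConfD[OF l] by simp_all
  note l_ker = Conf_kernel[OF l]
  have epi: "u = v" if "u \<cdot> d' = v \<cdot> d'" "u \<in> Mor A" "v \<in> Mor A" "Cod A u = Cod A v"
    "Dom A u = Dom A p" "Dom A v = Dom A p" for u v
    using cokernel_cancel[OF Conf_cokernel[OF n] that(1)] that by simp
  \<comment> \<open>Parallel sides of a pullback square have the same kernel: \<open>d'\<close>
    carries the kernel of \<open>p'\<close> to that of \<open>p\<close>.\<close>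
  let ?m = "d' \<cdot> k"
  have "(p \<cdot> d') \<cdot> k = p \<cdot> ?m" by simp
  moreover have "(p \<cdot> (s \<cdot> p')) \<cdot> k = Zero A (Dom A k) (Cod A p)" by simp
  ultimately have pm: "p \<cdot> ?m = Zero A (Dom A k) (Cod A p)" by (simp only: sq)
  have m_ker: "is_kernel A p ?m"
  proof (rule is_kernelI)
    show "p \<cdot> ?m = Zero A (Dom A ?m) (Cod A p)" using pm by simp
  next
    fix u assume u [simp]: "u \<in> Mor A" "Cod A u = Dom A p" "p \<cdot> u = Zero A (Dom A u) (Cod A p)"
    obtain w where w [simp]: "w \<in> Mor A" "Cod A w = P" "Dom A w = Dom A u"
      "p' \<cdot> w = Zero A (Dom A u) (Dom A s)" "d' \<cdot> w = u"
      using op.pushout_factor[OF op_pb, of "Zero A (Dom A u) (Dom A s)" u] by auto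
    obtain x where "x \<in> Mor A" "Dom A x = Dom A w" "Cod A x = Dom A k" "k \<cdot> x = w"
      using kernel_factor[OF Conf_kernel[OF k], of w] by auto
    then show "\<exists>w. w \<in> homset A (Dom A u) (Dom A ?m) \<and> ?m \<cdot> w = u"
      by (intro exI[of _ x]) (simp add: homset_iff)
  next
    fix u v assume eq: "?m \<cdot> u = ?m \<cdot> v" and uv: "u \<in> Mor A" "v \<in> Mor A"
      "Dom A u = Dom A v" "Cod A u = Dom A ?m" "Cod A v = Dom A ?m"
    then have [simp]: "u \<in> Mor A" "v \<in> Mor A" "Dom A u = Dom A v"
      "Cod A u = Dom A k" "Cod A v = Dom A k" by simp_all
    show "u = v"
    proof (rule kernel_cancel[OF Conf_kernel[OF k]])
      show "k \<cdot> u = k \<cdot> v"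
      proof (rule op.pushout_cancel[OF op_pb])
        have "p' \<cdot> (k \<cdot> u) = p' \<cdot> (k \<cdot> v)"
          using Comp_eq_extend1[OF ConfD(4)[OF k], of u] Comp_eq_extend1[OF ConfD(4)[OF k], of v] by simp
        then show "(k \<cdot> u) \<cdot>\<^bsub>opposite A\<^esub> p' = (k \<cdot> v) \<cdot>\<^bsub>opposite A\<^esub> p'" by simp
      qed (use eq in simp_all)
    qed simp_all
  qed simp_all
  \<comment> \<open>\<open>g\<close> is what \<open>d'\<close> induces from the kernel of
    \<open>p \<cdot> d'\<close> to the kernel of \<open>p\<close>. It has the section
    \<open>h\<close> and kills \<open>n'\<close>, which comes from the kernel of \<open>d'\<close>.
    In the pushout property \<open>gn\<close> lets a cocone descend along \<open>d'\<close>, and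
    \<open>gh\<close> identifies its value on the second leg.\<close>
  obtain g where g [simp]: "g \<in> Mor A" "Dom A g = Dom A l" "Cod A g = Dom A k"
    and mg: "?m \<cdot> g = d' \<cdot> l"
    using kernel_factor[OF m_ker, of "d' \<cdot> l"] lD(3) by auto
  obtain h where h [simp]: "h \<in> Mor A" "Dom A h = Dom A k" "Cod A h = Dom A l" "l \<cdot> h = k"
    using kernel_factor[OF l_ker, of k] pm by auto
  have gh: "g \<cdot> h = Id A (Dom A k)"
    by (rule kernel_cancel[OF m_ker]) (use Comp_eq_extend[OF mg, of h] in simp_all)
  obtain n' where n' [simp]: "n' \<in> Mor A" "Dom A n' = Dom A n" "Cod A n' = Dom A l" "l \<cdot> n' = n"
    using kernel_factor[OF l_ker, of n] by auto
  have gn: "g \<cdot> n' = Zero A (Dom A n) (Dom A k)"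
    by (rule kernel_cancel[OF m_ker]) (use Comp_eq_extend[OF mg, of n'] in simp_all)
  have po: "is_pushout A l g d' ?m"
    unfolding is_pushout_def
  proof (intro conjI ballI impI)
    fix T u v assume T: "T \<in> Obj A" "u \<in> homset A (Cod A l) T" "v \<in> homset A (Cod A g) T"
      and eq: "u \<cdot> l = v \<cdot> g"
    have [simp]: "u \<in> Mor A" "Dom A u = P" "Cod A u = T" "v \<in> Mor A" "Dom A v = Dom A k" "Cod A v = T"
      using T by (simp_all add: homset_iff)
    have "u \<cdot> n = Zero A (Dom A n) T"
      using Comp_eq_extend[OF eq, of n'] gn T(1) by simp
    then obtain w where w [simp]: "w \<in> Mor A" "Dom A w = Dom A p" "Cod A w = T" "w \<cdot> d' = u"
      using cokernel_factor[OF Conf_cokernel[OF n], of u] by auto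
    have "w \<cdot> ?m = u \<cdot> k" using Comp_eq_extend1[OF w(4), of k] by simp
    also have "\<dots> = v" using Comp_eq_extend[OF eq, of h] gh by simp
    finally have wm: "w \<cdot> ?m = v" .
    show "\<exists>!w. w \<in> homset A (Cod A d') T \<and> w \<cdot> d' = u \<and> w \<cdot> ?m = v"
    proof (rule ex1I[of _ w])
      fix w' assume "w' \<in> homset A (Cod A d') T \<and> w' \<cdot> d' = u \<and> w' \<cdot> ?m = v"
      then show "w' = w" by - (rule epi, simp_all add: homset_iff)
    qed (use wm in \<open>simp add: homset_iff\<close>)
  qed (use mg in simp_all)
  obtain f' i' where po': "is_pushout A l g f' i'" and i': "i' \<in> inflations A"
    using inflation_pushout[of l g] l by (auto simp: inflations_def)
  obtain b where "is_iso A b" "b \<in> homset A (Cod A i') (Cod A ?m)" "b \<cdot> i' = ?m"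
    using pushout_unique[OF po' po] by metis
  then have m: "?m \<in> inflations A" using iso_Comp_inflation[OF i', of b] by (simp add: homset_iff)
  have "is_cokernel A ?m p"
  proof (rule is_cokernelI)
    fix u assume u [simp]: "u \<in> Mor A" "Dom A u = Cod A ?m" and um: "u \<cdot> ?m = Zero A (Dom A ?m) (Cod A u)"
    have "u \<cdot> (d' \<cdot> l) = Zero A (Dom A l) (Cod A u)"
      unfolding mg[symmetric] using Comp_eq_extend1[OF um, of g] by simp
    then obtain w where w [simp]: "w \<in> Mor A" "Dom A w = Cod A p" "Cod A w = Cod A u" "w \<cdot> (p \<cdot> d') = u \<cdot> d'"
      using cokernel_factor[OF Conf_cokernel[OF l], of "u \<cdot> d'"] by auto
    have "w \<cdot> p = u" by (rule epi) simp_all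
    then show "\<exists>w. w \<in> homset A (Cod A p) (Cod A u) \<and> w \<cdot> p = u"
      by (intro exI[of _ w]) (simp add: homset_iff)
  next
    fix u v assume [simp]: "u \<in> Mor A" "v \<in> Mor A" "Cod A u = Cod A v" "Dom A u = Cod A p" "Dom A v = Cod A p"
      and eq: "u \<cdot> p = v \<cdot> p"
    show "u = v"
      by (rule cokernel_cancel[OF Conf_cokernel[OF l]]) (use Comp_eq_extend[OF eq, of d'] in simp_all)
  qed (use pm in simp_all)
  from inflation_cokernel[OF m this] show ?thesis by (auto simp: deflations_def)
qed

end

section \<open>Weak factorization systems on exact categories\<close>

text \<open>Each class is determined by lifting against the other, so the axioms are invariant under
  passing to \<open>opposite A\<close> and exchanging \<open>L\<close> with \<open>R\<close>.
  Closure under retracts is contained in the two equivalences.\<close>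

locale exact_wfs = exact_category A
  for A :: "('o, 'm, 'z) exact_category_scheme" (structure) +
  fixes L R :: "'m set"
  assumes L_iff: "i \<in> L \<longleftrightarrow> i \<in> Mor A \<and> (\<forall>p \<in> R. has_lifting A i p)"
    and R_iff: "p \<in> R \<longleftrightarrow> p \<in> Mor A \<and> (\<forall>i \<in> L. has_lifting A i p)"
    and factorization: "f \<in> Mor A \<Longrightarrow> \<exists>j q. j \<in> L \<and> q \<in> R \<and> Dom A q = Cod A j \<and> f = q \<cdot> j"
begin

abbreviation "\<C> \<equiv> cofibrant_objects A L"
text \<open>For \<open>R\<close> the trivial fibrations these are the trivially fibrant objects, by
  \<open>trivially_fibrant_objects_eq\<close>.\<close>

abbreviation "\<F> \<equiv> fibrant_objects A R"

lemma exact_wfs_opposite: "exact_wfs (opposite A) R L"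
proof (intro exact_wfs.intro exact_wfs_axioms.intro exact_category_opposite)
  fix f assume "f \<in> Mor (opposite A)"
  then obtain j q where "j \<in> L \<and> q \<in> R \<and> Dom A q = Cod A j \<and> f = q \<cdot> j"
    using factorization[of f] by (simp only: opposite_sel) blast
  then show "\<exists>j q. j \<in> R \<and> q \<in> L \<and> Dom (opposite A) q = Cod (opposite A) j \<and> f = q \<cdot>\<^bsub>opposite A\<^esub> j"
    by (intro exI[of _ q] exI[of _ j]) simp
qed (simp_all add: L_iff[symmetric] R_iff[symmetric])

lemma L_Mor: "i \<in> L \<Longrightarrow> i \<in> Mor A"
  and R_Mor: "p \<in> R \<Longrightarrow> p \<in> Mor A"
  using L_iff R_iff by blast+

lemma L_R_lifting: "i \<in> L \<Longrightarrow> p \<in> R \<Longrightarrow> has_lifting A i p"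
  using L_iff by blast

text \<open>In a lifting problem for the morphism from zero to \<open>X\<close> the upper triangle
  commutes automatically, so only the lower one remains. The choice of the zero object disappears
  with it.\<close>

lemma cofibrant_iff:
  "X \<in> \<C> \<longleftrightarrow> X \<in> Obj A \<and>
    (\<forall>p \<in> R. \<forall>v \<in> homset A X (Cod A p). \<exists>h \<in> homset A X (Dom A p). p \<cdot> h = v)"
proof
  assume "X \<in> \<C>"
  then obtain Z where X [simp]: "X \<in> Obj A" and Z: "zero_object A Z" and ZX: "Zero A Z X \<in> L"
    by (auto simp: cofibrant_objects_def)
  have [simp]: "Z \<in> Obj A" using Z by (simp add: zero_object_def)
  show "X \<in> Obj A \<and>
    (\<forall>p \<in> R. \<forall>v \<in> homset A X (Cod A p). \<exists>h \<in> homset A X (Dom A p). p \<cdot> h = v)"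
  proof (intro conjI ballI X)
    fix p v assume p: "p \<in> R" and v: "v \<in> homset A X (Cod A p)"
    then obtain h where "h \<in> Mor A" "Dom A h = X" "Cod A h = Dom A p" "p \<cdot> h = v"
      using has_liftingE[OF L_R_lifting[OF ZX p], of "Zero A Z (Dom A p)" v] R_Mor[OF p]
      by (auto simp: homset_iff)
    then show "\<exists>h \<in> homset A X (Dom A p). p \<cdot> h = v"
      by (intro bexI[of _ h]) (simp_all add: homset_iff)
  qed
next
  assume *: "X \<in> Obj A \<and>
    (\<forall>p \<in> R. \<forall>v \<in> homset A X (Cod A p). \<exists>h \<in> homset A X (Dom A p). p \<cdot> h = v)"
  obtain Z where Z: "zero_object A Z" using ex_zero_object by blast
  then have [simp]: "Z \<in> Obj A" "X \<in> Obj A" using * by (simp_all add: zero_object_def)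
  have "has_lifting A (Zero A Z X) p" if p: "p \<in> R" for p
    unfolding has_lifting_def
  proof (intro ballI impI)
    fix u v assume u: "u \<in> homset A (Dom A (Zero A Z X)) (Dom A p)"
      and v: "v \<in> homset A (Cod A (Zero A Z X)) (Cod A p)"
    then have p': "p \<in> Mor A" using R_Mor[OF p] by simp
    from v obtain h where h: "h \<in> homset A X (Dom A p)" "p \<cdot> h = v" using * p by auto
    moreover have "h \<cdot> Zero A Z X = u"
      by (rule zero_object_unique[OF Z]) (use h u p' in \<open>simp_all add: homset_iff\<close>)
    ultimately show "\<exists>h \<in> homset A (Cod A (Zero A Z X)) (Dom A p). h \<cdot> Zero A Z X = u \<and> p \<cdot> h = v"
      by auto
  qed
  then have "Zero A Z X \<in> L" by (simp add: L_iff)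
  with Z show "X \<in> \<C>" by (auto simp: cofibrant_objects_def)
qed

lemma fibrant_iff:
  "Y \<in> \<F> \<longleftrightarrow> Y \<in> Obj A \<and>
    (\<forall>i \<in> L. \<forall>u \<in> homset A (Dom A i) Y. \<exists>h \<in> homset A (Cod A i) Y. h \<cdot> i = u)"
proof -
  interpret op: exact_wfs "opposite A" R L by (rule exact_wfs_opposite)
  show ?thesis using op.cofibrant_iff[of Y] by simp
qed

lemma cofibrant_Obj: "\<C> \<subseteq> Obj A"
  and fibrant_Obj: "\<F> \<subseteq> Obj A"
  by (auto simp: cofibrant_objects_def fibrant_objects_def)

text \<open>To lift \<open>v\<close> along \<open>p\<close>, first lift \<open>v \<cdot> c\<close>
  with the zero map prescribed on \<open>Dom A i\<close>. This lift kills \<open>i\<close> and so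
  descends to the cokernel.\<close>

lemma cokernel_cofibrant:
  assumes i: "i \<in> L" and c: "is_cokernel A i c"
  shows "Cod A c \<in> \<C>"
  unfolding cofibrant_iff
proof (intro conjI ballI)
  note [simp] = is_cokernelD[OF c]
  show "Cod A c \<in> Obj A" by simp
  fix p v assume p: "p \<in> R" and v: "v \<in> homset A (Cod A c) (Cod A p)"
  have [simp]: "v \<in> Mor A" "Dom A v = Cod A c" "Cod A v = Cod A p" "p \<in> Mor A"
    using v R_Mor[OF p] by (simp_all add: homset_iff)
  obtain h where h [simp]: "h \<in> Mor A" "Dom A h = Cod A i" "Cod A h = Dom A p"
    "h \<cdot> i = Zero A (Dom A i) (Dom A p)" "p \<cdot> h = v \<cdot> c"
    using has_liftingE[OF L_R_lifting[OF i p], of "Zero A (Dom A i) (Dom A p)" "v \<cdot> c"] by auto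
  obtain w where w [simp]: "w \<in> Mor A" "Dom A w = Cod A c" "Cod A w = Dom A p" "w \<cdot> c = h"
    using cokernel_factor[OF c, of h] by auto
  have "p \<cdot> w = v" by (rule cokernel_cancel[OF c]) simp_all
  then show "\<exists>h \<in> homset A (Cod A c) (Dom A p). p \<cdot> h = v"
    by (intro bexI[of _ w]) (simp_all add: homset_iff)
qed

lemma kernel_fibrant:
  assumes "p \<in> R" "is_kernel A p k"
  shows "Dom A k \<in> \<F>"
proof -
  interpret op: exact_wfs "opposite A" R L by (rule exact_wfs_opposite)
  show ?thesis using op.cokernel_cofibrant[of p k] assms by simp
qed

text \<open>Its dual \<open>R_pullback\<close> is what keeps the kernel of the pulled back deflation
  fibrant in \<open>inflation_in_L\<close>.\<close>

lemma L_pushout: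
  assumes i: "i \<in> L" and po: "is_pushout A i f f' i'"
  shows "i' \<in> L"
proof -
  note D [simp] = is_pushoutD(1-8)[OF po] and sq = is_pushoutD(9)[OF po]
  have "has_lifting A i' p" if p: "p \<in> R" for p
    unfolding has_lifting_def
  proof (intro ballI impI)
    fix u v assume uv: "u \<in> homset A (Dom A i') (Dom A p)" "v \<in> homset A (Cod A i') (Cod A p)"
      and eq: "p \<cdot> u = v \<cdot> i'"
    have [simp]: "u \<in> Mor A" "Dom A u = Cod A f" "Cod A u = Dom A p" "v \<in> Mor A"
      "Dom A v = Cod A i'" "Cod A v = Cod A p" "p \<in> Mor A"
      using uv R_Mor[OF p] by (simp_all add: homset_iff)
    have "p \<cdot> (u \<cdot> f) = (p \<cdot> u) \<cdot> f" by simp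
    also have "\<dots> = (v \<cdot> i') \<cdot> f" by (simp only: eq)
    also have "\<dots> = v \<cdot> (f' \<cdot> i)" unfolding sq by simp
    also have "\<dots> = (v \<cdot> f') \<cdot> i" by simp
    finally have "p \<cdot> (u \<cdot> f) = (v \<cdot> f') \<cdot> i" .
    then obtain h where h [simp]: "h \<in> Mor A" "Dom A h = Cod A i" "Cod A h = Dom A p"
      "h \<cdot> i = u \<cdot> f" "p \<cdot> h = v \<cdot> f'"
      using has_liftingE[OF L_R_lifting[OF i p], of "u \<cdot> f" "v \<cdot> f'"] by auto
    obtain w where w [simp]: "w \<in> Mor A" "Dom A w = Cod A i'" "Cod A w = Dom A p"
      "w \<cdot> f' = h" "w \<cdot> i' = u"
      using pushout_factor[OF po, of h u] by auto
    have "p \<cdot> w = v" by (rule pushout_cancel[OF po]) (use eq in simp_all)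
    then show "\<exists>h \<in> homset A (Cod A i') (Dom A p). h \<cdot> i' = u \<and> p \<cdot> h = v"
      by (intro bexI[of _ w]) (simp_all add: homset_iff)
  qed
  then show ?thesis by (simp add: L_iff)
qed

lemma R_pullback:
  assumes "p \<in> R" "is_pullback A p f f' p'"
  shows "p' \<in> R"
proof -
  interpret op: exact_wfs "opposite A" R L by (rule exact_wfs_opposite)
  show ?thesis using op.L_pushout[of p f f' p'] assms by simp
qed

text \<open>
  Let \<open>P\<close> be the pullback of \<open>p \<in> R\<close> along the bottom of the lifting square, with kernel \<open>k\<close> of
  \<open>P \<rightarrow> Y\<close>. The kernel \<open>m\<close> of \<open>P \<rightarrow> Y \<rightarrow> Cod c\<close> has domain \<open>Dom k \<oplus> X\<close>, and the
  pushout of \<open>m\<close> along the projection \<open>q\<close> to \<open>Dom k\<close> is an extension of a cofibrant by a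
  fibrant object. Its splitting provides a retraction \<open>P \<rightarrow> Dom k\<close> vanishing on \<open>X\<close>, which is
  the same as a section of \<open>P \<rightarrow> Y\<close> extending \<open>X \<rightarrow> P\<close>.
\<close>

lemma inflation_in_L:
  assumes vanish: "Ext1_vanishes A \<C> \<F>" and RD: "R \<subseteq> deflations A"
    and i: "i \<in> inflations A" and c: "is_cokernel A i c" and cC: "Cod A c \<in> \<C>"
  shows "i \<in> L"
proof -
  interpret op: exact_wfs "opposite A" R L by (rule exact_wfs_opposite)
  have ic: "(i, c) \<in> Conf A" using i c by (rule inflation_cokernel)
  then have cd: "c \<in> deflations A" by (auto simp: deflations_def)
  note cD [simp] = is_cokernelD[OF c]
  have "has_lifting A i p" if p: "p \<in> R" for p
    unfolding has_lifting_def
  proof (intro ballI impI)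
    fix u v assume uv: "u \<in> homset A (Dom A i) (Dom A p)" "v \<in> homset A (Cod A i) (Cod A p)"
      and eq: "p \<cdot> u = v \<cdot> i"
    have [simp]: "u \<in> Mor A" "Dom A u = Dom A i" "Cod A u = Dom A p" "v \<in> Mor A"
      "Dom A v = Cod A i" "Cod A v = Cod A p" "p \<in> Mor A"
      using uv R_Mor[OF p] by (simp_all add: homset_iff)
    \<comment> \<open>The pullback exists because \<open>p\<close> is a deflation, by
      \<open>RD\<close>.\<close>
    obtain v' p' where pb: "is_pullback A p v v' p'" and p'd: "p' \<in> deflations A"
      using deflation_pullback[of p v] p RD by auto
    note op_pb = pb[folded is_pushout_opposite]
    define P where "P = Dom A p'"
    have [simp]: "v' \<in> Mor A" "p' \<in> Mor A" "Dom A v' = P" "Dom A p' = P" "Cod A v' = Dom A p"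
      "Cod A p' = Cod A i" "P \<in> Obj A"
      using op.is_pushoutD(4-8)[OF op_pb] unfolding P_def by simp_all
    have sq: "p \<cdot> v' = v \<cdot> p'" using op.is_pushoutD(9)[OF op_pb] by simp
    obtain w where w [simp]: "w \<in> Mor A" "Cod A w = P" "Dom A w = Dom A i" "v' \<cdot> w = u" "p' \<cdot> w = i"
      using op.pushout_factor[OF op_pb, of u i] eq by auto
    obtain k where k: "(k, p') \<in> Conf A" using p'd by (auto simp: deflations_def)
    have [simp]: "k \<in> Mor A" "Cod A k = P" "p' \<cdot> k = Zero A (Dom A k) (Cod A i)"
      using ConfD[OF k] by simp_all
    have kF: "Dom A k \<in> \<F>"
      using kernel_fibrant[OF R_pullback[OF p pb] Conf_kernel[OF k]] .
    have "c \<cdot> p' \<in> deflations A" using deflation_Comp[OF p'd cd] by simp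
    then obtain m where m: "(m, c \<cdot> p') \<in> Conf A" by (auto simp: deflations_def)
    have [simp]: "m \<in> Mor A" "Cod A m = P" "c \<cdot> (p' \<cdot> m) = Zero A (Dom A m) (Cod A c)"
      using ConfD[OF m] by simp_all
    \<comment> \<open>\<open>a\<close> and \<open>b\<close> are the inclusions of
      \<open>Dom A k\<close> and \<open>Dom A i\<close> into \<open>Dom A m\<close>;
      \<open>q\<close> and \<open>e\<close> will be the corresponding projections.\<close>
    obtain a where a [simp]: "a \<in> Mor A" "Dom A a = Dom A k" "Cod A a = Dom A m" "m \<cdot> a = k"
      using kernel_factor[OF Conf_kernel[OF m], of k] by auto
    obtain b where b [simp]: "b \<in> Mor A" "Dom A b = Dom A i" "Cod A b = Dom A m" "m \<cdot> b = w"
      using kernel_factor[OF Conf_kernel[OF m], of w] by auto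
    obtain e where e [simp]: "e \<in> Mor A" "Dom A e = Dom A m" "Cod A e = Dom A i"
      and ie: "i \<cdot> e = p' \<cdot> m"
      using kernel_factor[OF Conf_kernel[OF ic], of "p' \<cdot> m"] by auto
    have eb: "e \<cdot> b = Id A (Dom A i)"
      by (rule kernel_cancel[OF Conf_kernel[OF ic]]) (use Comp_eq_extend[OF ie, of b] in simp_all)
    have ea: "e \<cdot> a = Zero A (Dom A k) (Dom A i)"
      by (rule kernel_cancel[OF Conf_kernel[OF ic]]) (use Comp_eq_extend[OF ie, of a] in simp_all)
    \<comment> \<open>\<open>t\<close> is \<open>m - w e\<close>, that is, \<open>m\<close> without
      its component along \<open>w\<close>. Since \<open>p'\<close> kills it, it factors through
      \<open>k\<close>, which defines \<open>q\<close>.\<close>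
    obtain t where t: "t \<in> homset A (Dom A m) P" "m = w \<cdot> e \<boxplus> t"
      using ex_difference[of m "Dom A m" P "w \<cdot> e"] by (auto simp: homset_iff)
    have [simp]: "t \<in> Mor A" "Dom A t = Dom A m" "Cod A t = P"
      using t(1) by (simp_all add: homset_iff)
    have tx: "m \<cdot> x = w \<cdot> (e \<cdot> x) \<boxplus> t \<cdot> x" if "x \<in> Mor A" "Cod A x = Dom A m" for x
    proof -
      have "m \<cdot> x = (w \<cdot> e \<boxplus> t) \<cdot> x" by (simp only: t(2)[symmetric])
      then show ?thesis using that by simp
    qed
    have "p' \<cdot> m = p' \<cdot> (w \<cdot> e \<boxplus> t)" by (simp only: t(2)[symmetric])
    also have "\<dots> = p' \<cdot> m \<boxplus> p' \<cdot> t"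
      using Comp_eq_extend1[OF w(5), of e] ie by simp
    finally have "p' \<cdot> m \<boxplus> p' \<cdot> t = p' \<cdot> m \<boxplus> Zero A (Dom A m) (Cod A i)" by simp
    then have "p' \<cdot> t = Zero A (Dom A m) (Cod A i)"
      by (rule Add_left_cancel[rotated 3]) (simp_all add: homset_iff)
    then obtain q where q [simp]: "q \<in> Mor A" "Dom A q = Dom A m" "Cod A q = Dom A k" "k \<cdot> q = t"
      using kernel_factor[OF Conf_kernel[OF k], of t] by auto
    have "t \<cdot> a = k" using tx[of a, symmetric] ea by simp
    then have qa: "q \<cdot> a = Id A (Dom A k)"
      by - (rule kernel_cancel[OF Conf_kernel[OF k]], use Comp_eq_extend1[OF q(4), of a] in simp_all)
    have "w \<boxplus> t \<cdot> b = w \<boxplus> Zero A (Dom A i) P" using tx[of b, symmetric] eb by simp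
    then have "t \<cdot> b = Zero A (Dom A i) P"
      by (rule Add_left_cancel[rotated 3]) (simp_all add: homset_iff)
    then have qb: "q \<cdot> b = Zero A (Dom A i) (Dom A k)"
      by - (rule kernel_cancel[OF Conf_kernel[OF k]], use Comp_eq_extend1[OF q(4), of b] in simp_all)
    obtain q' m' where po: "is_pushout A m q q' m'" and m': "m' \<in> inflations A"
      using inflation_pushout[of m q] m by (auto simp: inflations_def)
    obtain d' where d': "is_cokernel A m' d'" "Cod A d' = Cod A c"
      using pushout_cokernel[OF po Conf_cokernel[OF m]] by auto
    have [simp]: "m' \<in> Mor A" "Dom A m' = Dom A k" "q' \<in> Mor A" "Dom A q' = P" "Cod A q' = Cod A m'"
      using is_pushoutD[OF po] by simp_all
    \<comment> \<open>The pushed out conflation starts in \<open>\<F>\<close> and ends in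
      \<open>\<C>\<close>; here the vanishing of \<open>Ext1\<close> enters.\<close>
    obtain r' where r': "r' \<in> homset A (Cod A m') (Dom A k)" "r' \<cdot> m' = Id A (Dom A k)"
      using vanish inflation_cokernel[OF m' d'(1)] kF cC d'(2)
      unfolding Ext1_vanishes_iff[OF cofibrant_Obj fibrant_Obj] by fastforce
    have [simp]: "r' \<in> Mor A" "Dom A r' = Cod A m'" "Cod A r' = Dom A k"
      using r' by (simp_all add: homset_iff)
    \<comment> \<open>\<open>r\<close> extends \<open>q\<close> from \<open>Dom A m\<close> to all
      of \<open>P\<close>, so it inherits the values of \<open>q\<close> on both inclusions: the
      identity on \<open>k\<close> and zero on \<open>w\<close>.\<close>
    define r where "r = r' \<cdot> q'"
    have [simp]: "r \<in> Mor A" "Dom A r = P" "Cod A r = Dom A k" by (simp_all add: r_def)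
    have "r \<cdot> m = r' \<cdot> (m' \<cdot> q)" by (simp add: r_def is_pushoutD(9)[OF po])
    then have rm: "r \<cdot> m = q" using Comp_eq_extend1[OF r'(2), of q] by simp
    have rk: "r \<cdot> k = Id A (Dom A k)" using Comp_eq_extend1[OF rm, of a] qa by simp
    have rw: "r \<cdot> w = Zero A (Dom A i) (Dom A k)" using Comp_eq_extend1[OF rm, of b] qb by simp
    obtain h where bp: "is_biproduct A (Dom A k) (Cod A i) P k h r p'"
      using split_inflation[OF k, of r] rk by (auto simp: homset_iff)
    have [simp]: "h \<in> Mor A" "Dom A h = Cod A i" "Cod A h = P" using is_biproductD[OF bp] by simp_all
    \<comment> \<open>As \<open>r\<close> kills \<open>w\<close>, only the second summand of the
      identity of \<open>P\<close> survives on \<open>w\<close>. This makes the section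
      \<open>h\<close> extend the prescribed map.\<close>
    have "w = (k \<cdot> r \<boxplus> h \<cdot> p') \<cdot> w" using is_biproductD(20)[OF bp] by simp
    then have hi: "h \<cdot> i = w" using rw by simp
    have "p \<cdot> (v' \<cdot> h) = v"
      using Comp_eq_extend[OF sq, of h] is_biproductD(17)[OF bp] by simp
    then show "\<exists>h \<in> homset A (Cod A i) (Dom A p). h \<cdot> i = u \<and> p \<cdot> h = v"
      using hi by (intro bexI[of _ "v' \<cdot> h"]) (simp_all add: homset_iff)
  qed
  then show ?thesis by (simp add: L_iff)
qed

section \<open>Conditions (1) and (3) compared with (2)\<close>

lemma cofibrations_characterization_iff:
  "L = inflations_with_cokernel_in A \<C> \<and> R \<subseteq> deflations A \<longleftrightarrow>
    Ext1_vanishes A \<C> \<F> \<and> L \<subseteq> inflations A \<and> R \<subseteq> deflations A"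
proof (intro iffI; elim conjE)
  assume L: "L = inflations_with_cokernel_in A \<C>" and R: "R \<subseteq> deflations A"
  have "Ext1_vanishes A \<C> \<F>"
    unfolding Ext1_vanishes_iff[OF cofibrant_Obj fibrant_Obj]
  proof (intro allI impI)
    fix i d assume id: "(i, d) \<in> Conf A" "Cod A d \<in> \<C>" "Dom A i \<in> \<F>"
    then have "i \<in> inflations_with_cokernel_in A \<C>"
      using Conf_cokernel unfolding inflations_with_cokernel_in_def inflations_def by blast
    with L have "i \<in> L" by (simp only:)
    \<comment> \<open>The kernel is fibrant and \<open>i\<close> is in \<open>L\<close>, so this
      identity extends along \<open>i\<close>; the extension is the retraction.\<close>
    moreover have "Id A (Dom A i) \<in> homset A (Dom A i) (Dom A i)"
      using ConfD[OF id(1)] by (simp add: homset_iff)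
    ultimately show "\<exists>r \<in> homset A (Cod A i) (Dom A i). r \<cdot> i = Id A (Dom A i)"
      using id(3) unfolding fibrant_iff by blast
  qed
  with L R show "Ext1_vanishes A \<C> \<F> \<and> L \<subseteq> inflations A \<and> R \<subseteq> deflations A"
    by (auto simp: inflations_with_cokernel_in_def)
next
  assume E: "Ext1_vanishes A \<C> \<F>" and L: "L \<subseteq> inflations A" and R: "R \<subseteq> deflations A"
  have "i \<in> inflations_with_cokernel_in A \<C>" if i: "i \<in> L" for i
  proof -
    obtain d where d: "(i, d) \<in> Conf A" using L i by (auto simp: inflations_def)
    then show ?thesis using cokernel_cofibrant[OF i Conf_cokernel[OF d]] Conf_cokernel[OF d]
      by (auto simp: inflations_with_cokernel_in_def inflations_def)
  qed
  then show "L = inflations_with_cokernel_in A \<C> \<and> R \<subseteq> deflations A"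
    using inflation_in_L[OF E R] R by (auto simp: inflations_with_cokernel_in_def)
qed

lemma trivial_fibrations_characterization_iff:
  "R = deflations_with_kernel_in A \<F> \<and> L \<subseteq> inflations A \<longleftrightarrow>
    Ext1_vanishes A \<C> \<F> \<and> L \<subseteq> inflations A \<and> R \<subseteq> deflations A"
proof -
  interpret op: exact_wfs "opposite A" R L by (rule exact_wfs_opposite)
  show ?thesis
    using op.cofibrations_characterization_iff Ext1_vanishes_opposite[OF cofibrant_Obj fibrant_Obj]
    by auto
qed

section \<open>From condition (2) to a complete cotorsion pair\<close>

lemma enough_cofibrant:
  assumes R: "R \<subseteq> deflations A" and X: "X \<in> Obj A"
  obtains k q where "(k, q) \<in> Conf A" "Dom A k \<in> \<F>" "Cod A k \<in> \<C>" "Cod A q = X"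
proof -
  obtain Z where Z: "zero_object A Z" using ex_zero_object by blast
  then have [simp]: "Z \<in> Obj A" by (simp add: zero_object_def)
  obtain j q where jq: "j \<in> L" "q \<in> R" "Dom A q = Cod A j" "Zero A Z X = q \<cdot> j"
    using factorization[of "Zero A Z X"] X by auto
  have [simp]: "j \<in> Mor A" "q \<in> Mor A" using jq L_Mor R_Mor by auto
  have "Dom A (q \<cdot> j) = Z" "Cod A (q \<cdot> j) = X" unfolding jq(4)[symmetric] using X by simp_all
  then have [simp]: "Dom A j = Z" "Cod A q = X" using jq(3) by simp_all
  have "j = Zero A Z (Cod A j)" by (rule zero_object_unique[OF Z]) simp_all
  then have C: "Cod A j \<in> \<C>" using Z jq(1) by (auto simp: cofibrant_objects_def)
  obtain k where k: "(k, q) \<in> Conf A" using R jq by (auto simp: deflations_def)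
  show ?thesis
    using that[OF k kernel_fibrant[OF jq(2) Conf_kernel[OF k]]] ConfD(3)[OF k] jq(3) C by simp
qed

lemma enough_fibrant:
  assumes "L \<subseteq> inflations A" "X \<in> Obj A"
  obtains i d where "(i, d) \<in> Conf A" "Dom A i = X" "Cod A i \<in> \<F>" "Cod A d \<in> \<C>"
proof -
  interpret op: exact_wfs "opposite A" R L by (rule exact_wfs_opposite)
  show ?thesis using op.enough_cofibrant[of X] assms that ConfD(3) by auto
qed

text \<open>Take a deflation onto \<open>X\<close> from a cofibrant object with kernel in
  \<open>\<F>\<close>. The hypothesis on \<open>Ext1\<close> splits it, so \<open>X\<close> is a
  retract of a cofibrant object, and lifting along \<open>R\<close> passes to retracts.\<close>

lemma cofibrantI:
  assumes R: "R \<subseteq> deflations A" and X: "X \<in> Obj A"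
    and ext: "\<And>Y. Y \<in> \<F> \<Longrightarrow> Ext1 A X Y = {Ext1_zero A X Y}"
  shows "X \<in> \<C>"
proof -
  obtain k q where kq: "(k, q) \<in> Conf A" "Dom A k \<in> \<F>" "Cod A k \<in> \<C>" "Cod A q = X"
    using enough_cofibrant[OF R X] .
  then have "\<forall>(i, d) \<in> extensions A X (Dom A k). \<exists>r \<in> homset A (Cod A i) (Dom A k). r \<cdot> i = Id A (Dom A k)"
    using ext[OF kq(2)] Ext1_trivial_iff[OF X, of "Dom A k"] fibrant_Obj by auto
  then obtain s where s: "s \<in> homset A X (Dom A q)" "q \<cdot> s = Id A X"
    using kq split_conflation_iff[OF kq(1)] by (auto simp: extensions_def)
  note [simp] = ConfD(1-3)[OF kq(1)]
  have [simp]: "s \<in> Mor A" "Dom A s = X" "Cod A s = Cod A k" using s by (simp_all add: homset_iff)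
  show ?thesis unfolding cofibrant_iff
  proof (intro conjI X ballI)
    fix p v assume p: "p \<in> R" and v: "v \<in> homset A X (Cod A p)"
    have [simp]: "v \<in> Mor A" "Dom A v = X" "Cod A v = Cod A p" "p \<in> Mor A"
      using v R_Mor[OF p] by (simp_all add: homset_iff)
    have "v \<cdot> q \<in> homset A (Cod A k) (Cod A p)" using kq(4) by (simp add: homset_iff)
    then obtain h where h: "h \<in> homset A (Cod A k) (Dom A p)" "p \<cdot> h = v \<cdot> q"
      using kq(3) p unfolding cofibrant_iff by blast
    then have "p \<cdot> (h \<cdot> s) = v"
      using Comp_eq_extend[OF h(2), of s] s(2) kq(4) by (simp add: homset_iff)
    then show "\<exists>h \<in> homset A X (Dom A p). p \<cdot> h = v"
      using h(1) by (intro bexI[of _ "h \<cdot> s"]) (simp_all add: homset_iff)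
  qed
qed

lemma fibrantI:
  assumes L: "L \<subseteq> inflations A" and Y: "Y \<in> Obj A"
    and ext: "\<And>X. X \<in> \<C> \<Longrightarrow> Ext1 A X Y = {Ext1_zero A X Y}"
  shows "Y \<in> \<F>"
proof -
  interpret op: exact_wfs "opposite A" R L by (rule exact_wfs_opposite)
  have "Ext1 (opposite A) Y X = {Ext1_zero (opposite A) Y X}" if "X \<in> \<C>" for X
    using Ext1_trivial_opposite_iff[of X Y] ext that Y cofibrant_Obj by auto
  then show ?thesis using op.cofibrantI[of Y] L Y by simp
qed

lemma complete_cotorsion_pairI:
  assumes E: "Ext1_vanishes A \<C> \<F>" and L: "L \<subseteq> inflations A" and R: "R \<subseteq> deflations A"
  shows "complete_cotorsion_pair A \<C> \<F>"
proof -
  have triv: "Ext1 A X Y = {Ext1_zero A X Y}" if "X \<in> \<C>" "Y \<in> \<F>" for X Y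
    using E that unfolding Ext1_vanishes_def by blast
  have "{X \<in> Obj A. \<forall>Y \<in> \<F>. Ext1 A X Y = {Ext1_zero A X Y}} \<subseteq> \<C>"
    using cofibrantI[OF R] by blast
  moreover have "{Y \<in> Obj A. \<forall>X \<in> \<C>. Ext1 A X Y = {Ext1_zero A X Y}} \<subseteq> \<F>"
    using fibrantI[OF L] by blast
  moreover have "\<C> \<subseteq> {X \<in> Obj A. \<forall>Y \<in> \<F>. Ext1 A X Y = {Ext1_zero A X Y}}"
    "\<F> \<subseteq> {Y \<in> Obj A. \<forall>X \<in> \<C>. Ext1 A X Y = {Ext1_zero A X Y}}"
    using triv cofibrant_Obj fibrant_Obj by blast+
  ultimately have "cotorsion_pair A \<C> \<F>"
    unfolding cotorsion_pair_def by (intro conjI equalityI)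
  moreover have "\<exists>(i, d) \<in> Conf A. Dom A i \<in> \<F> \<and> Cod A i \<in> \<C> \<and> Cod A d = X" if "X \<in> Obj A" for X
    using enough_cofibrant[OF R that] by blast
  moreover have "\<exists>(i, d) \<in> Conf A. Dom A i = X \<and> Cod A i \<in> \<F> \<and> Cod A d \<in> \<C>" if "X \<in> Obj A" for X
    using enough_fibrant[OF L that] by blast
  ultimately show ?thesis unfolding complete_cotorsion_pair_def by blast
qed

section \<open>From a complete cotorsion pair back to condition (2)\<close>

lemma R_deflations:
  assumes wic: "weakly_idempotent_complete A"
    and enough: "\<And>X. X \<in> Obj A \<Longrightarrow> \<exists>d \<in> deflations A. Dom A d \<in> \<C> \<and> Cod A d = X"
  shows "R \<subseteq> deflations A"
proof
  fix p assume p: "p \<in> R"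
  then obtain d where d: "d \<in> deflations A" "Dom A d \<in> \<C>" "Cod A d = Cod A p"
    using enough[of "Cod A p"] R_Mor by auto
  then have "d \<in> homset A (Dom A d) (Cod A p)" using deflation_Mor by (simp add: homset_iff)
  then obtain s where "s \<in> homset A (Dom A d) (Dom A p)" "p \<cdot> s = d"
    using d(2) p unfolding cofibrant_iff by blast
  then show "p \<in> deflations A"
    using deflation_right_factor[OF wic R_Mor[OF p], of s] d(1) by (simp add: homset_iff)
qed

lemma L_inflations:
  assumes "weakly_idempotent_complete A"
    and "\<And>X. X \<in> Obj A \<Longrightarrow> \<exists>i \<in> inflations A. Cod A i \<in> \<F> \<and> Dom A i = X"
  shows "L \<subseteq> inflations A"
proof -
  interpret op: exact_wfs "opposite A" R L by (rule exact_wfs_opposite)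
  show ?thesis
    using op.R_deflations weakly_idempotent_complete_opposite assms by simp
qed

lemma complete_cotorsion_pairD:
  assumes wic: "weakly_idempotent_complete A" and cp: "complete_cotorsion_pair A \<C> \<F>"
  shows "Ext1_vanishes A \<C> \<F> \<and> L \<subseteq> inflations A \<and> R \<subseteq> deflations A"
proof (intro conjI)
  show "Ext1_vanishes A \<C> \<F>"
    using cp unfolding complete_cotorsion_pair_def cotorsion_pair_def Ext1_vanishes_def by blast
  show "R \<subseteq> deflations A"
  proof (rule R_deflations[OF wic])
    fix X assume "X \<in> Obj A"
    then obtain i d where "(i, d) \<in> Conf A" "Cod A i \<in> \<C>" "Cod A d = X"
      using cp unfolding complete_cotorsion_pair_def by blast
    then show "\<exists>d \<in> deflations A. Dom A d \<in> \<C> \<and> Cod A d = X"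
      using ConfD(3)[of i d] by (auto simp: deflations_def)
  qed
  show "L \<subseteq> inflations A"
  proof (rule L_inflations[OF wic])
    fix X assume "X \<in> Obj A"
    then obtain i d where "(i, d) \<in> Conf A" "Dom A i = X" "Cod A i \<in> \<F>"
      using cp unfolding complete_cotorsion_pair_def by blast
    then show "\<exists>i \<in> inflations A. Cod A i \<in> \<F> \<and> Dom A i = X"
      by (auto simp: inflations_def)
  qed
qed

lemma conditions_equivalent:
  "let
      C = \<C>; TF = \<F>; TFib = R;
      cond1 = (L = inflations_with_cokernel_in A C \<and> TFib \<subseteq> deflations A);
      cond2 = (Ext1_vanishes A C TF \<and> L \<subseteq> inflations A \<and> TFib \<subseteq> deflations A);
      cond3 = (TFib = deflations_with_kernel_in A TF \<and> L \<subseteq> inflations A);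
      cond4 = (L = inflations_with_cokernel_in A C \<and> TFib = deflations_with_kernel_in A TF);
      cond5 = complete_cotorsion_pair A C TF
    in (cond1 \<longleftrightarrow> cond2) \<and> (cond1 \<longleftrightarrow> cond3) \<and> (cond1 \<longleftrightarrow> cond4) \<and>
       (weakly_idempotent_complete A \<longrightarrow>
          (cond1 \<longleftrightarrow> cond5) \<and> (cond2 \<longleftrightarrow> cond5) \<and> (cond3 \<longleftrightarrow> cond5) \<and> (cond4 \<longleftrightarrow> cond5))"
proof -
  note c12 = cofibrations_characterization_iff and c32 = trivial_fibrations_characterization_iff
  \<comment> \<open>With this inclusion, (4) implies (1), since its second equation already makes
    trivial fibrations deflations. Conversely (2) gives both equations of (4), one through (1) and
    one through (3).\<close>
  have "deflations_with_kernel_in A \<F> \<subseteq> deflations A"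
    by (auto simp: deflations_with_kernel_in_def)
  then have c42: "L = inflations_with_cokernel_in A \<C> \<and> R = deflations_with_kernel_in A \<F> \<longleftrightarrow>
    Ext1_vanishes A \<C> \<F> \<and> L \<subseteq> inflations A \<and> R \<subseteq> deflations A"
    using c12 c32 by argo
  show ?thesis
    unfolding Let_def c12 c32 c42 using complete_cotorsion_pairI complete_cotorsion_pairD by blast
qed

end

section \<open>Model structures\<close>

context model_structure
begin

text \<open>The axioms do not list identities. Factoring the identity as \<open>p \<cdot> i\<close>
  exhibits it as a retract of the trivial cofibration \<open>i\<close>.\<close>

lemma Id_CoFib_Weq: "X \<in> Obj A \<Longrightarrow> Id A X \<in> CoFib \<inter> Weq"
proof -
  assume X: "X \<in> Obj A"
  obtain i p where ip: "i \<in> CoFib \<inter> Weq" "p \<in> Fib" "Dom A p = Cod A i" "Id A X = p \<cdot> i"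
    using factor_trivial_CoFib_Fib[of "Id A X"] X by auto
  have [simp]: "i \<in> Mor A" "p \<in> Mor A" using ip CoFib_Mor Fib_Mor by auto
  have "Dom A (p \<cdot> i) = X" "Cod A (p \<cdot> i) = X" unfolding ip(4)[symmetric] using X by simp_all
  then have [simp]: "Dom A i = X" "Cod A p = X" using ip(3) by simp_all
  have "retract_of A (Id A X) i"
    by (rule retract_ofI[of _ _ "Id A X" "Id A X" i p])
      (use X ip(3) ip(4)[symmetric] in \<open>simp_all add: homset_iff\<close>)
  then show ?thesis using retract_CoFib retract_Weq ip(1) by blast
qed

text \<open>An isomorphism is a retract of the identity of its domain. This is used to compare
  different zero objects.\<close>

lemma iso_Weq:
  assumes "is_iso A f"
  shows "f \<in> Weq"
proof -
  obtain g where g: "g \<in> homset A (Cod A f) (Dom A f)" "g \<cdot> f = Id A (Dom A f)"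
    "f \<cdot> g = Id A (Cod A f)" using is_isoE[OF assms] by metis
  have [simp]: "f \<in> Mor A" "g \<in> Mor A" "Dom A g = Cod A f" "Cod A g = Dom A f"
    using g assms by (simp_all add: homset_iff is_iso_def)
  have "retract_of A f (Id A (Dom A f))"
    by (rule retract_ofI[of _ _ "Id A (Dom A f)" "Id A (Dom A f)" g f])
      (use g in \<open>simp_all add: homset_iff\<close>)
  then show ?thesis using retract_Weq Id_CoFib_Weq by auto
qed

text \<open>The retract argument: lifting \<open>f\<close> against its own second factor
  \<open>q\<close> gives a section of \<open>q\<close> under which \<open>f\<close> becomes
  \<open>j\<close>.\<close>

lemma has_lifting_retract_left:
  assumes "f = q \<cdot> j" "q \<in> Mor A" "j \<in> Mor A" "Dom A q = Cod A j" "has_lifting A f q"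
  shows "retract_of A f j"
proof -
  note [simp] = assms(2-4)
  have [simp]: "f \<in> Mor A" "Dom A f = Dom A j" "Cod A f = Cod A q" using assms(1) by simp_all
  have "q \<cdot> j = Id A (Cod A q) \<cdot> f" using assms(1) by simp
  then obtain h where h: "h \<in> Mor A" "Dom A h = Cod A q" "Cod A h = Cod A j"
    "h \<cdot> f = j" "q \<cdot> h = Id A (Cod A q)"
    using has_liftingE[OF assms(5), of j "Id A (Cod A q)"] by auto
  show ?thesis
    by (rule retract_ofI[of _ _ "Id A (Dom A j)" "Id A (Dom A j)" h q])
      (use h assms(1) in \<open>simp_all add: homset_iff\<close>)
qed

lemma has_lifting_retract_right:
  assumes "f = q \<cdot> j" "q \<in> Mor A" "j \<in> Mor A" "Dom A q = Cod A j" "has_lifting A j f"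
  shows "retract_of A f q"
proof -
  note [simp] = assms(2-4)
  have [simp]: "f \<in> Mor A" "Dom A f = Dom A j" "Cod A f = Cod A q" using assms(1) by simp_all
  have "f \<cdot> Id A (Dom A j) = q \<cdot> j" using assms(1) by simp
  then obtain h where h: "h \<in> Mor A" "Dom A h = Cod A j" "Cod A h = Dom A j"
    "h \<cdot> j = Id A (Dom A j)" "f \<cdot> h = q"
    using has_liftingE[OF assms(5), of "Id A (Dom A j)" q] by auto
  show ?thesis
    by (rule retract_ofI[of _ _ j h "Id A (Cod A q)" "Id A (Cod A q)"])
      (use h assms(1) in \<open>simp_all add: homset_iff\<close>)
qed

end

text \<open>The lifting axiom gives one direction of each characterization. For the other, factor
  the morphism and apply the retract argument; \<open>Fib \<inter> Weq\<close> is closed under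
  retracts because both classes are.\<close>

lemma exact_wfs_model_structure:
  assumes "exact_category A" "model_structure A CoFib Fib Weq"
  shows "exact_wfs A CoFib (Fib \<inter> Weq)"
proof -
  interpret exact_category A by fact
  interpret M: model_structure A CoFib Fib Weq by fact
  show ?thesis
  proof
    fix i show "i \<in> CoFib \<longleftrightarrow> i \<in> Mor A \<and> (\<forall>p \<in> Fib \<inter> Weq. has_lifting A i p)"
    proof
      assume i: "i \<in> Mor A \<and> (\<forall>p \<in> Fib \<inter> Weq. has_lifting A i p)"
      then obtain j q where "j \<in> CoFib" "q \<in> Fib \<inter> Weq" "Dom A q = Cod A j" "i = Comp A q j"
        using M.factor_CoFib_trivial_Fib by blast
      then show "i \<in> CoFib"
        using M.has_lifting_retract_left[of i q j] i M.retract_CoFib M.CoFib_Mor M.Fib_Mor by blast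
    qed (use M.CoFib_Mor M.lifting_CoFib in blast)
  next
    fix p show "p \<in> Fib \<inter> Weq \<longleftrightarrow> p \<in> Mor A \<and> (\<forall>i \<in> CoFib. has_lifting A i p)"
    proof
      assume p: "p \<in> Mor A \<and> (\<forall>i \<in> CoFib. has_lifting A i p)"
      then obtain j q where "j \<in> CoFib" "q \<in> Fib \<inter> Weq" "Dom A q = Cod A j" "p = Comp A q j"
        using M.factor_CoFib_trivial_Fib by blast
      then show "p \<in> Fib \<inter> Weq"
        using M.has_lifting_retract_right[of p q j] p M.retract_Fib M.retract_Weq M.CoFib_Mor M.Fib_Mor
        by blast
    qed (use M.Fib_Mor M.lifting_CoFib in blast)
  qed (rule M.factor_CoFib_trivial_Fib)
qed

text \<open>Triviality is tested on a morphism from zero to \<open>X\<close> and fibrancy on one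
  from \<open>X\<close> to zero, possibly with different zero objects. Their composite is an
  isomorphism, hence a weak equivalence, and two out of three transfers the property.\<close>

lemma trivially_fibrant_objects_eq:
  assumes "exact_category A" "model_structure A CoFib Fib Weq"
  shows "trivially_fibrant_objects A Fib Weq = fibrant_objects A (Fib \<inter> Weq)"
proof -
  interpret exact_category A by fact
  interpret M: model_structure A CoFib Fib Weq by fact
  have weq: "Zero A Z X \<in> Weq \<longleftrightarrow> Zero A X Z' \<in> Weq"
    if Z: "zero_object A Z" "zero_object A Z'" and X: "X \<in> Obj A" for X Z Z'
  proof -
    have [simp]: "Z \<in> Obj A" "Z' \<in> Obj A" using Z by (simp_all add: zero_object_def)
    have "Comp A (Zero A Z' Z) (Zero A Z Z') = Id A Z" "Comp A (Zero A Z Z') (Zero A Z' Z) = Id A Z'"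
      by (rule zero_object_unique[OF Z(1)] zero_object_unique[OF Z(2)]; simp)+
    then have "is_iso A (Zero A Z Z')"
      by (intro is_isoI[of _ Z Z' "Zero A Z' Z"]) (simp_all add: homset_iff)
    then have "Comp A (Zero A X Z') (Zero A Z X) \<in> Weq" using M.iso_Weq X by simp
    then show ?thesis
      using M.two_of_three(2,3)[of "Zero A Z X" Z X "Zero A X Z'" Z'] X by (auto simp: homset_iff)
  qed
  show ?thesis
    unfolding trivially_fibrant_objects_def trivial_objects_def fibrant_objects_def
    using weq by blast
qed

theorem proposition5p2:
  fixes A :: "('o, 'm, 'z) exact_category_scheme"
    and CoFib Fib Weq :: "'m set"
  assumes "exact_category A"
    and "model_structure A CoFib Fib Weq"
  shows "let
      C = cofibrant_objects A CoFib;
      TF = trivially_fibrant_objects A Fib Weq;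
      TFib = Fib \<inter> Weq;
      cond1 = (CoFib = inflations_with_cokernel_in A C \<and> TFib \<subseteq> deflations A);
      cond2 = (Ext1_vanishes A C TF \<and> CoFib \<subseteq> inflations A \<and> TFib \<subseteq> deflations A);
      cond3 = (TFib = deflations_with_kernel_in A TF \<and> CoFib \<subseteq> inflations A);
      cond4 = (CoFib = inflations_with_cokernel_in A C \<and> TFib = deflations_with_kernel_in A TF);
      cond5 = complete_cotorsion_pair A C TF
    in (cond1 \<longleftrightarrow> cond2) \<and> (cond1 \<longleftrightarrow> cond3) \<and> (cond1 \<longleftrightarrow> cond4) \<and>
       (weakly_idempotent_complete A \<longrightarrow>
          (cond1 \<longleftrightarrow> cond5) \<and> (cond2 \<longleftrightarrow> cond5) \<and> (cond3 \<longleftrightarrow> cond5) \<and> (cond4 \<longleftrightarrow> cond5))"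
proof -
  interpret exact_wfs A CoFib "Fib \<inter> Weq" using exact_wfs_model_structure assms .
  show ?thesis
    unfolding trivially_fibrant_objects_eq[OF assms] by (rule conditions_equivalent)
qed

end
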